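(* Let $\Omega\subset\mathbb{R}^d$ be a bounded domain with smooth boundary, let $\rho\in C^\infty(\bar\Omega)$ be strictly positive, and put $Z_\rho:=\int_\Omega\rho\,dx$, $p:=\rho/Z_\rho$. Let $q_0$ be a strictly positive probability density on $\Omega$ such that $\omega_0:=\log\rho-\log q_0\in C^{0,1}(\bar\Omega)$, and let $(\omega,\phi)$ be the corresponding unique global solution of the WLF system with initial datum $\omega_0$ (see context). Let $q_t$ be the density transported from $q_0$ by the velocity $v=\nabla\phi$, i.e. $\partial_tq+\nabla\cdot(qv)=0$. Then, with $$\eta(t,x):=\omega(t,x)-\log Z_\rho=\log\frac{p(x)}{q_t(x)},$$ we have $$\|\eta(t,\cdot)\|_{L^\infty(\Omega)}\le e^{-t}\operatorname{osc}\omega_0\qquad\text{for all }t\ge0.$$ Consequently, $$\|q_t-p\|_{L^\infty(\Omega)}\longrightarrow0\ \ (t\to\infty),\qquad \mathrm{KL}(q_t\,\|\,p)\le e^{-t}\operatorname{osc}\omega_0\ \ \text{for all }t\ge0.$$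
   Context: WLF system. A global solution with initial datum $\omega_0$ is a pair of functions $\omega,\phi$ on $[0,\infty)\times\bar\Omega$, together with the scalar function $\bar\omega(t)$ and the flow $X(t,x)$ of $\nabla\phi$, such that for all $t\ge0$: (1) $\frac1\rho\nabla\cdot(\rho\nabla\phi)=-(\omega-\bar\omega)$ in $\Omega$; (2) $\frac{d}{dt}\omega(t,X(t,x))=-(\omega(t,X(t,x))-\bar\omega(t))$ for every $x\in\bar\Omega$; (3) $\frac{d}{dt}X(t,x)=\nabla\phi(t,X(t,x))$, $X(0,x)=x$; (4) $\partial\phi/\partial n=0$ on $\partial\Omega$; (5) $\int_\Omega\rho(x)(\omega(t,x)-\bar\omega(t))\,dx=0$ and $\int_\Omega\phi(t,x)\,dx=0$; and $\omega(0,\cdot)=\omega_0$. The solution considered is the unique one with, for every $T<\infty$ and every $\alpha\in(0,1)$, $\omega\in L^\infty([0,T];C^{0,1}(\bar\Omega))\cap C([0,T];C^{0,\alpha}(\bar\Omega))$ and $\phi\in L^\infty([0,T];C^{2,\alpha}(\bar\Omega))\cap C([0,T];C^{2,\alpha}(\bar\Omega))$; it exists for every $\omega_0\in C^{0,1}(\bar\Omega)$. Transport of $q_0$ by $v$ means $q_t=X(t,\cdot)_\#q_0$ (pushforward of densities). Notation: $\operatorname{osc}u=\max_{\bar\Omega}u-\min_{\bar\Omega}u$; $\mathrm{KL}(q\,\|\,p)=\int_\Omega q\log(q/p)\,dx$. *)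

theory Defs
  imports "HOL-Probability.Probability"
begin

text \<open>
  Functions on the closure of an open set \<open>\<Omega>\<close> are total functions of which only the values on
  \<^term>\<open>closure \<Omega>\<close> matter.  Derivatives are taken in \<open>\<Omega>\<close> and extended continuously to boundary
  points; if there is no limit, the value there is junk and \<open>Ck\<close> below fails.
\<close>

definition cont_ext :: "'a::euclidean_space set \<Rightarrow> ('a \<Rightarrow> real) \<Rightarrow> 'a \<Rightarrow> real" where
  "cont_ext \<Omega> f x = (if x \<in> \<Omega> then f x else Lim (at x within \<Omega>) f)"

definition partial_deriv :: "'a::euclidean_space set \<Rightarrow> 'a \<Rightarrow> ('a \<Rightarrow> real) \<Rightarrow> 'a \<Rightarrow> real" where
  "partial_deriv \<Omega> b f = cont_ext \<Omega> (\<lambda>x. frechet_derivative f (at x) b)"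

definition grad :: "'a::euclidean_space set \<Rightarrow> ('a \<Rightarrow> real) \<Rightarrow> 'a \<Rightarrow> 'a" where
  "grad \<Omega> f x = (\<Sum>b\<in>Basis. partial_deriv \<Omega> b f x *\<^sub>R b)"

definition divergence :: "('a::euclidean_space \<Rightarrow> 'a) \<Rightarrow> 'a \<Rightarrow> real" where
  "divergence F x = (\<Sum>b\<in>Basis. frechet_derivative F (at x) b \<bullet> b)"

text \<open>
  For \<open>\<Omega>\<close> open and \<open>\<Omega> \<subseteq> S \<subseteq> closure \<Omega>\<close>: \<open>f\<close> is \<open>k\<close> times continuously differentiable in \<open>\<Omega>\<close> and its
  partial derivatives of order up to \<open>k\<close> extend continuously to \<open>S\<close>.  Thus \<open>S = \<Omega>\<close> gives
  \<open>C\<^sup>k(\<Omega>)\<close>, and \<open>S = closure \<Omega>\<close> gives the space \<open>C\<^sup>k\<close> on the closure.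
\<close>

primrec Ck :: "nat \<Rightarrow> 'a::euclidean_space set \<Rightarrow> 'a set \<Rightarrow> ('a \<Rightarrow> real) \<Rightarrow> bool" where
  "Ck 0 \<Omega> S f \<longleftrightarrow> continuous_on S f"
| "Ck (Suc k) \<Omega> S f \<longleftrightarrow> continuous_on S f \<and> (\<forall>x\<in>\<Omega>. f differentiable (at x)) \<and>
     (\<forall>b\<in>Basis. Ck k \<Omega> S (partial_deriv \<Omega> b f))"

definition Cinf :: "'a::euclidean_space set \<Rightarrow> 'a set \<Rightarrow> ('a \<Rightarrow> real) \<Rightarrow> bool" where
  "Cinf \<Omega> S f \<longleftrightarrow> (\<forall>k. Ck k \<Omega> S f)"

definition sup_norm :: "'a set \<Rightarrow> ('a \<Rightarrow> real) \<Rightarrow> ennreal" where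
  "sup_norm S u = (SUP x\<in>S. ennreal \<bar>u x\<bar>)"

definition holder_seminorm :: "real \<Rightarrow> 'a::metric_space set \<Rightarrow> ('a \<Rightarrow> real) \<Rightarrow> ennreal" where
  "holder_seminorm \<alpha> S u = (SUP x\<in>S. SUP y\<in>S - {x}. ennreal (\<bar>u x - u y\<bar> / dist x y powr \<alpha>))"

text \<open>
  The norm of \<open>C\<^sup>k\<^sup>,\<^sup>\<alpha>\<close> on the closure: sup norms of all partial derivatives of order up to \<open>k\<close> plus
  the \<open>\<alpha>\<close>-seminorms of those of order \<open>k\<close>.  Each ordering of a mixed partial derivative is
  counted separately, which gives an equivalent norm.
\<close>

primrec holder_norm :: "nat \<Rightarrow> real \<Rightarrow> 'a::euclidean_space set \<Rightarrow> ('a \<Rightarrow> real) \<Rightarrow> ennreal" where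
  "holder_norm 0 \<alpha> \<Omega> u = sup_norm (closure \<Omega>) u + holder_seminorm \<alpha> (closure \<Omega>) u"
| "holder_norm (Suc k) \<alpha> \<Omega> u =
     sup_norm (closure \<Omega>) u + (\<Sum>b\<in>Basis. holder_norm k \<alpha> \<Omega> (partial_deriv \<Omega> b u))"

definition holder_space :: "nat \<Rightarrow> real \<Rightarrow> 'a::euclidean_space set \<Rightarrow> ('a \<Rightarrow> real) set" where
  "holder_space k \<alpha> \<Omega> = {u. Ck k \<Omega> (closure \<Omega>) u \<and> holder_norm k \<alpha> \<Omega> u < \<infinity>}"

text \<open>
  \<open>L\<^sup>\<infinity>([0,T]; C\<^sup>k\<^sup>,\<^sup>\<alpha>)\<close>.  Only essential boundedness is required; strong measurability is not, as
  Hoelder spaces are not separable.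
\<close>

definition Linf_holder ::
    "real \<Rightarrow> nat \<Rightarrow> real \<Rightarrow> 'a::euclidean_space set \<Rightarrow> (real \<Rightarrow> 'a \<Rightarrow> real) \<Rightarrow> bool" where
  "Linf_holder T k \<alpha> \<Omega> u \<longleftrightarrow> (\<exists>C::real. AE t in lebesgue_on {0..T}.
     u t \<in> holder_space k \<alpha> \<Omega> \<and> holder_norm k \<alpha> \<Omega> (u t) \<le> ennreal C)"

definition Cont_holder ::
    "real \<Rightarrow> nat \<Rightarrow> real \<Rightarrow> 'a::euclidean_space set \<Rightarrow> (real \<Rightarrow> 'a \<Rightarrow> real) \<Rightarrow> bool" where
  "Cont_holder T k \<alpha> \<Omega> u \<longleftrightarrow> (\<forall>t\<in>{0..T}. u t \<in> holder_space k \<alpha> \<Omega> \<and>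
     ((\<lambda>s. holder_norm k \<alpha> \<Omega> (\<lambda>x. u s x - u t x)) \<longlongrightarrow> 0) (at t within {0..T}))"

definition local_defining_function ::
    "'a::euclidean_space set \<Rightarrow> 'a \<Rightarrow> 'a set \<Rightarrow> ('a \<Rightarrow> real) \<Rightarrow> bool" where
  "local_defining_function \<Omega> x U g \<longleftrightarrow> open U \<and> x \<in> U \<and> Cinf U U g \<and>
     (\<forall>y\<in>U. grad U g y \<noteq> 0) \<and>
     \<Omega> \<inter> U = {y\<in>U. g y < 0} \<and> frontier \<Omega> \<inter> U = {y\<in>U. g y = 0}"

definition smooth_boundary :: "'a::euclidean_space set \<Rightarrow> bool" where
  "smooth_boundary \<Omega> \<longleftrightarrow> (\<forall>x\<in>frontier \<Omega>. \<exists>U g. local_defining_function \<Omega> x U g)"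

definition outward_unit_normal :: "'a::euclidean_space set \<Rightarrow> 'a \<Rightarrow> 'a \<Rightarrow> bool" where
  "outward_unit_normal \<Omega> x n \<longleftrightarrow>
     (\<exists>U g. local_defining_function \<Omega> x U g \<and> n = grad U g x /\<^sub>R norm (grad U g x))"

definition smooth_bounded_domain :: "'a::euclidean_space set \<Rightarrow> bool" where
  "smooth_bounded_domain \<Omega> \<longleftrightarrow>
     open \<Omega> \<and> connected \<Omega> \<and> \<Omega> \<noteq> {} \<and> bounded \<Omega> \<and> smooth_boundary \<Omega>"

text \<open>
  Time derivatives at \<open>t = 0\<close> are one-sided.  That the flow stays in the closed domain is implicit
  in evaluating \<open>\<omega>\<close> and \<open>\<nabla>\<phi>\<close> along it.
\<close>

definition wlf_solution ::
    "'a::euclidean_space set \<Rightarrow> ('a \<Rightarrow> real) \<Rightarrow> ('a \<Rightarrow> real) \<Rightarrow> (real \<Rightarrow> 'a \<Rightarrow> real) \<Rightarrow>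
     (real \<Rightarrow> 'a \<Rightarrow> real) \<Rightarrow> (real \<Rightarrow> real) \<Rightarrow> (real \<Rightarrow> 'a \<Rightarrow> 'a) \<Rightarrow> bool" where
  "wlf_solution \<Omega> \<rho> \<omega>\<^sub>0 \<omega> \<phi> \<omega>\<^sub>m X \<longleftrightarrow>
     (\<forall>t\<ge>0. \<forall>x\<in>\<Omega>. divergence (\<lambda>y. \<rho> y *\<^sub>R grad \<Omega> (\<phi> t) y) x / \<rho> x = - (\<omega> t x - \<omega>\<^sub>m t)) \<and>
     (\<forall>t\<ge>0. \<forall>x\<in>closure \<Omega>. X t x \<in> closure \<Omega> \<and>
        ((\<lambda>s. \<omega> s (X s x)) has_real_derivative - (\<omega> t (X t x) - \<omega>\<^sub>m t)) (at t within {0..})) \<and>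
     (\<forall>x\<in>closure \<Omega>. X 0 x = x) \<and>
     (\<forall>t\<ge>0. \<forall>x\<in>closure \<Omega>.
        ((\<lambda>s. X s x) has_vector_derivative grad \<Omega> (\<phi> t) (X t x)) (at t within {0..})) \<and>
     (\<forall>t\<ge>0. \<forall>x\<in>frontier \<Omega>. \<forall>n. outward_unit_normal \<Omega> x n \<longrightarrow> grad \<Omega> (\<phi> t) x \<bullet> n = 0) \<and>
     (\<forall>t\<ge>0. (LINT x|lebesgue_on \<Omega>. \<rho> x * (\<omega> t x - \<omega>\<^sub>m t)) = 0 \<and>
        (LINT x|lebesgue_on \<Omega>. \<phi> t x) = 0) \<and>
     (\<forall>x\<in>closure \<Omega>. \<omega> 0 x = \<omega>\<^sub>0 x)"

definition wlf_regular ::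
    "'a::euclidean_space set \<Rightarrow> (real \<Rightarrow> 'a \<Rightarrow> real) \<Rightarrow> (real \<Rightarrow> 'a \<Rightarrow> real) \<Rightarrow> bool" where
  "wlf_regular \<Omega> \<omega> \<phi> \<longleftrightarrow> (\<forall>T>0. \<forall>\<alpha>\<in>{0<..<1}.
     Linf_holder T 0 1 \<Omega> \<omega> \<and> Cont_holder T 0 \<alpha> \<Omega> \<omega> \<and>
     Linf_holder T 2 \<alpha> \<Omega> \<phi> \<and> Cont_holder T 2 \<alpha> \<Omega> \<phi>)"

text \<open>
  \<open>q\<close> is a (version of the) density of the push-forward of \<open>q\<^sub>0 dx\<close> under \<open>\<Phi>\<close>.  Both sides are
  Borel measures on the whole space.
\<close>

definition pushforward_density ::
    "'a::euclidean_space set \<Rightarrow> ('a \<Rightarrow> 'a) \<Rightarrow> ('a \<Rightarrow> real) \<Rightarrow> ('a \<Rightarrow> real) \<Rightarrow> bool" where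
  "pushforward_density \<Omega> \<Phi> q\<^sub>0 q \<longleftrightarrow>
     q \<in> borel_measurable (lebesgue_on \<Omega>) \<and> (\<forall>x\<in>\<Omega>. 0 \<le> q x) \<and>
     distr (density (lebesgue_on \<Omega>) (\<lambda>x. ennreal (q\<^sub>0 x))) borel \<Phi> =
     distr (density (lebesgue_on \<Omega>) (\<lambda>x. ennreal (q x))) borel (\<lambda>x. x)"

definition Linf_norm :: "'a::euclidean_space set \<Rightarrow> ('a \<Rightarrow> real) \<Rightarrow> ereal" where
  "Linf_norm \<Omega> u = esssup (lebesgue_on \<Omega>) (\<lambda>x. ereal \<bar>u x\<bar>)"

text \<open>For continuous \<open>u\<close> and bounded \<open>\<Omega>\<close> the supremum and infimum are attained.\<close>

definition osc :: "'a::euclidean_space set \<Rightarrow> ('a \<Rightarrow> real) \<Rightarrow> real" where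
  "osc \<Omega> u = (SUP x\<in>closure \<Omega>. u x) - (INF x\<in>closure \<Omega>. u x)"

definition KL :: "'a::euclidean_space set \<Rightarrow> ('a \<Rightarrow> real) \<Rightarrow> ('a \<Rightarrow> real) \<Rightarrow> real" where
  "KL \<Omega> q p = (LINT x|lebesgue_on \<Omega>. q x * ln (q x / p x))"

end

(* Along a trajectory X of the velocity v = grad phi, Liouville's formula and the elliptic equation
   give d/dt (ln det DX + ln rho(X)) = div (rho v) / rho = -(omega - omega_m) = d/dt omega(t, X).
   Hence det DX * rho(X) exp (-omega(t, X)) stays equal to q_0, that is, the transported density is
   q_t = rho exp (-omega_t), which is eta = ln (p / q_t).  The mean omega_m cancels in the difference
   of omega along two trajectories, so such differences decay exactly like exp (-t), and since X_t
   maps Omega onto itself the oscillation of eta_t is at most exp (-t) osc omega_0.  As p and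
   p exp (-eta) have the same mass, eta changes sign, so its sup norm is bounded by its oscillation.

   X_t preserves Omega because v is tangential at the boundary: the distance d of a trajectory to
   the boundary satisfies |d'| <= L d in the Dini sense. *)
theory Submission
  imports Defs
begin

section \<open>Comparison lemmas of Gronwall type\<close>

text \<open>About \<open>X\<close> only the trajectory equation and values in the closure are given:
  that it preserves the open domain, is bijective on it and is differentiable in the initial point
  has to be derived. The obstacle is that \<Omega> may be nonconvex, so a bound on the derivative
  makes the velocity Lipschitz only on balls inside \<Omega>. Hence the Gronwall lemmas carry a
  threshold, and trajectories are compared within a tube of balls around one of them.

  Why |d'| <= L d: let z be a boundary point nearest to y. The open ball about y of radius |y - z|
  lies in \<Omega>, so y - z is normal to the boundary at z and the velocity at z is orthogonal to
  it. The Lipschitz bound on that ball, closed up so as to reach z, then bounds the component of the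
  velocity at y along y - z by L |y - z|. This avoids extending the velocity across the boundary and
  differentiating the distance. Only upper Dini bounds arise in this way; the lower bound on d,
  which prevents exit, comes from running time backwards.\<close>

text \<open>Consider the last time up to \<open>t\<close> with \<open>f \<le> g\<close>. A strict
  inequality there persists by continuity, an equality by \<open>touch\<close>; so that time cannot
  precede \<open>t\<close>.\<close>

lemma barrier_le:
  fixes f g :: "real \<Rightarrow> real"
  assumes f: "continuous_on {a..b} f" and g: "continuous_on {a..b} g"
    and init: "f a \<le> g a"
    and touch: "\<And>t. t \<in> {a..<b} \<Longrightarrow> f t = g t \<Longrightarrow> \<forall>\<^sub>F s in at_right t. f s \<le> g s"
    and t: "t \<in> {a..b}"
  shows "f t \<le> g t"
proof (rule ccontr)
  assume neg: "\<not> f t \<le> g t"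
  define S where "S = {s \<in> {a..t}. f s \<le> g s}"
  have sub: "{a..t} \<subseteq> {a..b}" using t by auto
  have "closed S" unfolding S_def
    using continuous_on_subset[OF f sub] continuous_on_subset[OF g sub]
    by (intro continuous_on_closed_Collect_le) auto
  moreover have "a \<in> S" using init t by (auto simp: S_def)
  moreover have bdd: "bdd_above S" by (auto simp: S_def)
  ultimately have Sup: "Sup S \<in> S" using closed_contains_Sup by blast
  define t0 where "t0 = Sup S"
  have t0: "a \<le> t0" "t0 < t" "f t0 \<le> g t0"
    using Sup neg by (auto simp: S_def t0_def order_less_le)
  have after: "f s > g s" if "s \<in> {t0<..<t}" for s
    using cSup_upper[OF _ bdd, of s] that t0 by (force simp: S_def t0_def)
  have "\<forall>\<^sub>F s in at_right t0. f s \<le> g s"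
  proof (cases "f t0 = g t0")
    case True
    then show ?thesis using touch[of t0] t0 t by auto
  next
    case False
    have c: "continuous_on {t0..t} (\<lambda>s. g s - f s)"
      using t0 t by (intro continuous_intros continuous_on_subset[OF f] continuous_on_subset[OF g]) auto
    have "((\<lambda>s. g s - f s) \<longlongrightarrow> g t0 - f t0) (at_right t0)"
      using c t0 by (auto simp: continuous_on_def at_within_Icc_at_right dest!: bspec[of _ _ t0])
    from order_tendstoD(1)[OF this, of 0] False t0
    show ?thesis by (auto elim!: eventually_mono)
  qed
  moreover have "\<forall>\<^sub>F s in at_right t0. s \<in> {t0<..<t}"
    using t0 by (auto intro: eventually_at_rightI)
  ultimately have "\<forall>\<^sub>F s in at_right t0. False"
    by eventually_elim (use after in force)
  then show False by simp
qed

text \<open>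
  The differential inequality is needed only below the threshold \<open>\<delta>\<close>: vector fields on a nonconvex
  domain are Lipschitz only on balls inside it.
\<close>

lemma dini_gronwall:
  fixes f :: "real \<Rightarrow> real"
  assumes cont: "continuous_on {a..b} f" and nonneg: "0 \<le> f a" "0 \<le> L" "0 \<le> E"
    and dini: "\<And>t \<epsilon>. t \<in> {a..<b} \<Longrightarrow> f t < \<delta> \<Longrightarrow> 0 < \<epsilon> \<Longrightarrow>
      \<forall>\<^sub>F s in at_right t. f s \<le> f t + (L * f t + E + \<epsilon>) * (s - t)"
    and small: "(f a + E * (b - a)) * exp (L * (b - a)) < \<delta>"
    and t: "t \<in> {a..b}"
  shows "f t \<le> (f a + E * (t - a)) * exp (L * (t - a))"
proof -
  \<comment> \<open>The claimed bound with \<open>f a\<close> and \<open>E\<close> both raised by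
    \<kappa>. Where \<open>f\<close> touches it, its slope exceeds the Dini slope of
    \<open>f\<close> by at least \<kappa>/2; at the end \<kappa> tends to 0.\<close>
  define g where "g = (\<lambda>\<kappa> s. (f a + \<kappa> + (E + \<kappa>) * (s - a)) * exp (L * (s - a)))"
  have "((\<lambda>\<kappa>. g \<kappa> b) \<longlongrightarrow> g 0 b) (at_right 0)"
    unfolding g_def by (intro tendsto_intros)
  \<comment> \<open>Since \<open>small\<close> is strict, the raised barrier still ends below
    \<delta>. It is increasing in time, so every touching point lies below \<delta>, where
    \<open>dini\<close> applies.\<close>
  then have ev: "\<forall>\<^sub>F \<kappa> in at_right 0. g \<kappa> b < \<delta>"
    using small by (intro order_tendstoD(2)) (auto simp: g_def)
  have "\<forall>\<^sub>F \<kappa> in at_right 0. f t \<le> g \<kappa> t"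
    using ev eventually_at_right_less
  proof eventually_elim
    case (elim \<kappa>)
    have gmono: "g \<kappa> s \<le> g \<kappa> b" if "s \<in> {a..b}" for s
      unfolding g_def using that elim nonneg by (intro mult_mono add_mono) (auto intro: mult_left_mono)
    show ?case
    proof (rule barrier_le[OF cont _ _ _ t])
      show "continuous_on {a..b} (g \<kappa>)" unfolding g_def by (intro continuous_intros)
      show "f a \<le> g \<kappa> a" using elim by (simp add: g_def)
      fix s assume s: "s \<in> {a..<b}" and eq: "f s = g \<kappa> s"
      let ?g' = "(E + \<kappa>) * exp (L * (s - a)) + L * g \<kappa> s"
      have der: "(g \<kappa> has_real_derivative ?g') (at s)"
        unfolding g_def by (auto intro!: derivative_eq_intros simp: algebra_simps)
      have "E + \<kappa> \<le> (E + \<kappa>) * exp (L * (s - a))"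
        using s nonneg elim by (simp add: mult_le_cancel_left1)
      then have lt: "L * f s + E + \<kappa>/2 < ?g'" using elim eq by simp
      have "((\<lambda>y. (g \<kappa> y - g \<kappa> s) / (y - s)) \<longlongrightarrow> ?g') (at_right s)"
        using DERIV_subset[OF der, of "{s<..}"] by (simp add: has_field_derivative_iff)
      from order_tendstoD(1)[OF this lt]
      have 1: "\<forall>\<^sub>F y in at_right s. L * f s + E + \<kappa>/2 < (g \<kappa> y - g \<kappa> s) / (y - s)" .
      have 2: "\<forall>\<^sub>F y in at_right s. f y \<le> f s + (L * f s + E + \<kappa>/2) * (y - s)"
        using gmono[of s] s eq elim by (intro dini) auto
      show "\<forall>\<^sub>F y in at_right s. f y \<le> g \<kappa> y"
        using 1 2 eventually_at_right_less
        by eventually_elim (use eq in \<open>simp add: pos_less_divide_eq\<close>)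
    qed
  qed
  moreover have "((\<lambda>\<kappa>. g \<kappa> t) \<longlongrightarrow> g 0 t) (at_right 0)"
    unfolding g_def by (intro tendsto_intros)
  ultimately have "f t \<le> g 0 t"
    by (intro tendsto_lowerbound) auto
  then show ?thesis by (simp add: g_def)
qed

text \<open>The norm need not be differentiable along \<open>y\<close>, but the triangle inequality
  turns the first-order expansion of \<open>y\<close> into the one-sided growth bound that
  \<open>dini_gronwall\<close> asks for.\<close>

lemma norm_gronwall:
  fixes y :: "real \<Rightarrow> 'b::real_normed_vector"
  assumes der: "\<And>t. t \<in> {a..b} \<Longrightarrow> (y has_vector_derivative y' t) (at t within {a..b})"
    and nonneg: "0 \<le> L" "0 \<le> E"
    and bound: "\<And>t. t \<in> {a..b} \<Longrightarrow> norm (y t) < \<delta> \<Longrightarrow> norm (y' t) \<le> L * norm (y t) + E"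
    and small: "(norm (y a) + E * (b - a)) * exp (L * (b - a)) < \<delta>"
    and t: "t \<in> {a..b}"
  shows "norm (y t) \<le> (norm (y a) + E * (t - a)) * exp (L * (t - a))"
proof (rule dini_gronwall[where f = "\<lambda>t. norm (y t)", OF _ _ nonneg _ small t])
  show "0 \<le> norm (y a)" by simp
  have "continuous_on {a..b} y"
    using der by (rule continuous_on_vector_derivative)
  then show "continuous_on {a..b} (\<lambda>t. norm (y t))" by (intro continuous_intros)
  fix t \<epsilon> :: real assume t: "t \<in> {a..<b}" and d: "norm (y t) < \<delta>" and \<epsilon>: "0 < \<epsilon>"
  have "(y has_vector_derivative y' t) (at_right t)"
    using has_vector_derivative_within_subset[OF der[of t], of "{t..b}"] t
    by (auto simp: at_within_Icc_at_right)
  then have "\<forall>\<^sub>F s in at_right t. norm (y s - y t - (s - t) *\<^sub>R y' t) \<le> \<epsilon> * norm (s - t)"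
    using \<epsilon> by (simp add: has_vector_derivative_def has_derivative_within_alt2)
  then show "\<forall>\<^sub>F s in at_right t. norm (y s) \<le> norm (y t) + (L * norm (y t) + E + \<epsilon>) * (s - t)"
    using eventually_at_right_less
  proof eventually_elim
    case (elim s)
    have "norm (y s) = norm ((y s - y t - (s - t) *\<^sub>R y' t) + y t + (s - t) *\<^sub>R y' t)" by simp
    also have "\<dots> \<le> norm (y s - y t - (s - t) *\<^sub>R y' t) + norm (y t) + norm ((s - t) *\<^sub>R y' t)"
      using norm_triangle_ineq[of "y s - y t - (s - t) *\<^sub>R y' t + y t" "(s - t) *\<^sub>R y' t"]
        norm_triangle_ineq[of "y s - y t - (s - t) *\<^sub>R y' t" "y t"] by linarith
    also have "\<dots> \<le> \<epsilon> * (s - t) + norm (y t) + (s - t) * (L * norm (y t) + E)"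
      using elim bound[of t] d t by (intro add_mono) (auto intro!: mult_left_mono)
    finally show ?case by (simp add: algebra_simps)
  qed
qed

section \<open>Linear differential equations\<close>

text \<open>Picard iteration summed as a series: the increments are bounded by
  \<open>norm y0\<close> times the terms of the exponential series of \<open>C * T\<close>, so the
  series converges uniformly, and so does the series of derivatives.\<close>

lemma linear_ode_exists:
  fixes F :: "real \<Rightarrow> 'b::banach \<Rightarrow>\<^sub>L 'b"
  assumes T: "0 \<le> T" and F: "continuous_on {0..T} F"
  shows "\<exists>y. y 0 = y0 \<and> (\<forall>t\<in>{0..T}. (y has_vector_derivative F t (y t)) (at t within {0..T}))"
proof -
  obtain C where C: "\<And>t. t \<in> {0..T} \<Longrightarrow> norm (F t) \<le> C"
    using compact_imp_bounded[OF compact_continuous_image[OF F compact_Icc]]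
    by (force simp: bounded_iff)
  have C0: "0 \<le> C" using C[of 0] T order_trans[OF norm_ge_zero] by auto
  \<comment> \<open>By linearity these are the increments between successive Picard iterates, not
    the iterates themselves; the solution is their sum.\<close>
  define u where "u = rec_nat (\<lambda>_. y0) (\<lambda>_ w t. integral {0..t} (\<lambda>s. F s (w s)))"
  have u0: "u 0 = (\<lambda>_. y0)" and uS: "\<And>n. u (Suc n) = (\<lambda>t. integral {0..t} (\<lambda>s. F s (u n s)))"
    by (simp_all add: u_def)
  have cont: "continuous_on {0..T} (u n)" for n
  proof (induction n)
    case (Suc n)
    then have "continuous_on {0..T} (\<lambda>s. F s (u n s))" by (intro continuous_intros F)
    then show ?case unfolding uS
      by (intro indefinite_integral_continuous_1 integrable_continuous_real)
  qed (simp add: u0)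
  have contF: "continuous_on {0..T} (\<lambda>s. F s (u n s))" for n
    by (intro continuous_intros F cont)
  have der: "(u (Suc n) has_vector_derivative F t (u n t)) (at t within {0..T})"
    if "t \<in> {0..T}" for n t
    unfolding uS using contF that by (rule integral_has_vector_derivative)
  have bound: "norm (u n t) \<le> norm y0 * ((C * t) ^ n /\<^sub>R fact n)" if "t \<in> {0..T}" for n t
    using that
  proof (induction n arbitrary: t)
    case (Suc n)
    have I: "((\<lambda>s. norm y0 * C * ((C * s) ^ n /\<^sub>R fact n)) has_integral
        norm y0 * ((C * t) ^ Suc n /\<^sub>R fact (Suc n)) - norm y0 * ((C * 0) ^ Suc n /\<^sub>R fact (Suc n))) {0..t}"
    proof (rule fundamental_theorem_of_calculus)
      show "0 \<le> t" using Suc.prems by simp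
      fix s assume "s \<in> {0..t}"
      have "((\<lambda>s. norm y0 * ((C * s) ^ Suc n /\<^sub>R fact (Suc n))) has_real_derivative
          norm y0 * (real (Suc n) * (C * s) ^ n * C /\<^sub>R fact (Suc n))) (at s within {0..t})"
        by (rule derivative_eq_intros refl)+ (simp add: field_simps del: fact_Suc)
      also have "norm y0 * (real (Suc n) * (C * s) ^ n * C /\<^sub>R fact (Suc n)) =
          norm y0 * C * ((C * s) ^ n /\<^sub>R fact n)"
        by (simp add: divide_simps del: of_nat_Suc)
      finally show "((\<lambda>s. norm y0 * ((C * s) ^ Suc n /\<^sub>R fact (Suc n))) has_vector_derivative
          norm y0 * C * ((C * s) ^ n /\<^sub>R fact n)) (at s within {0..t})"
        by (simp add: has_real_derivative_iff_has_vector_derivative)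
    qed
    have le: "norm (F s (u n s)) \<le> norm y0 * C * ((C * s) ^ n /\<^sub>R fact n)" if "s \<in> {0..t}" for s
    proof -
      have s: "s \<in> {0..T}" using that Suc.prems by auto
      have "norm (F s (u n s)) \<le> norm (F s) * norm (u n s)" by (rule norm_blinfun)
      also have "\<dots> \<le> C * (norm y0 * ((C * s) ^ n /\<^sub>R fact n))"
        using C[OF s] Suc.IH[OF s] C0 by (intro mult_mono) auto
      finally show ?thesis by (simp add: mult_ac)
    qed
    have "(\<lambda>s. F s (u n s)) integrable_on {0..t}"
      using Suc.prems by (intro integrable_continuous_real continuous_on_subset[OF contF]) auto
    then have "norm (integral {0..t} (\<lambda>s. F s (u n s))) \<le>
        integral {0..t} (\<lambda>s. norm y0 * C * ((C * s) ^ n /\<^sub>R fact n))"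
      using has_integral_integrable[OF I] by (intro integral_norm_bound_integral le)
    also have "\<dots> = norm y0 * ((C * t) ^ Suc n /\<^sub>R fact (Suc n))"
      using integral_unique[OF I] by simp
    finally show ?case unfolding uS .
  qed (simp add: u0)
  define M where "M = (\<lambda>n. norm y0 * ((C * T) ^ n /\<^sub>R fact n))"
  have M: "summable M" unfolding M_def
    by (intro summable_mult summable_exp_generic)
  have uM: "norm (u n t) \<le> M n" if "t \<in> {0..T}" for n t
  proof -
    have "norm (u n t) \<le> norm y0 * ((C * t) ^ n /\<^sub>R fact n)" by (rule bound[OF that])
    also have "\<dots> \<le> M n" unfolding M_def using that C0
      by (intro mult_left_mono scaleR_left_mono power_mono) auto
    finally show ?thesis .
  qed
  define y where "y = (\<lambda>t. \<Sum>n. u n t)"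
  have unif: "uniform_limit {0..T} (\<lambda>n t. \<Sum>i<n. u i t) y sequentially"
    unfolding y_def by (rule Weierstrass_m_test[OF uM M])
  \<comment> \<open>The derivative of term \<open>Suc m\<close> is built from term \<open>m\<close>,
    so the first \<open>Suc n\<close> derivatives sum to \<open>F t\<close> applied to the first
    \<open>n\<close> terms. This index shift is undone at the end by
    \<open>eventually_sequentially_Suc\<close>.\<close>
  define G where "G = (\<lambda>n t h. case n of 0 \<Rightarrow> 0 | Suc m \<Rightarrow> h *\<^sub>R F t (u m t))"
  have sums: "(\<lambda>n. u n t) sums y t" if "t \<in> {0..T}" for t
    unfolding y_def by (intro summable_sums summable_comparison_test'[OF M] uM that)
  have "\<exists>g. \<forall>t\<in>{0..T}. (\<lambda>n. u n t) sums g t \<and>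
      (g has_derivative (\<lambda>h. h *\<^sub>R F t (y t))) (at t within {0..T})"
  proof (rule has_derivative_series)
    show "(u n has_derivative G n t) (at t within {0..T})" if "t \<in> {0..T}" for n t
      using der[OF that] by (cases n) (auto simp: G_def u0 has_vector_derivative_def)
    show "(\<lambda>n. u n 0) sums y 0" using sums T by simp
    \<comment> \<open>The tolerance used below is \<open>e / (C + 1)\<close> because
      \<open>C\<close> may be 0.\<close>
    fix e :: real assume e: "0 < e"
    have "\<forall>\<^sub>F n in sequentially. \<forall>t\<in>{0..T}. dist (\<Sum>i<n. u i t) (y t) < e / (C + 1)"
      using uniform_limitD[OF unif] e C0 by simp
    then have "\<forall>\<^sub>F n in sequentially. \<forall>t\<in>{0..T}. \<forall>h. norm ((\<Sum>i<Suc n. G i t h) - h *\<^sub>R F t (y t)) \<le> e * norm h"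
    proof eventually_elim
      case (elim n)
      show ?case
      proof (intro ballI allI)
        fix t h assume t: "t \<in> {0..T}"
        have "(\<Sum>i<Suc n. G i t h) - h *\<^sub>R F t (y t) = h *\<^sub>R F t ((\<Sum>i<n. u i t) - y t)"
          by (subst sum.lessThan_Suc_shift)
            (simp add: G_def blinfun.diff_right blinfun.sum_right scaleR_sum_right scaleR_diff_right)
        also have "norm \<dots> \<le> \<bar>h\<bar> * (norm (F t) * norm ((\<Sum>i<n. u i t) - y t))"
          by (simp add: mult_left_mono norm_blinfun)
        also have "\<dots> \<le> \<bar>h\<bar> * ((C + 1) * (e / (C + 1)))"
          using elim t C[OF t] C0 by (intro mult_left_mono mult_mono) (auto simp: dist_norm intro: less_imp_le)
        finally show "norm ((\<Sum>i<Suc n. G i t h) - h *\<^sub>R F t (y t)) \<le> e * norm h"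
          using C0 by (simp add: mult_ac)
      qed
    qed
    then show "\<forall>\<^sub>F n in sequentially. \<forall>t\<in>{0..T}. \<forall>h. norm ((\<Sum>i<n. G i t h) - h *\<^sub>R F t (y t)) \<le> e * norm h"
      by (subst (asm) eventually_sequentially_Suc)
  qed (use T in auto)
  then obtain g where g: "\<And>t. t \<in> {0..T} \<Longrightarrow> (\<lambda>n. u n t) sums g t"
    "\<And>t. t \<in> {0..T} \<Longrightarrow> (g has_derivative (\<lambda>h. h *\<^sub>R F t (y t))) (at t within {0..T})"
    by blast
  have gy: "g t = y t" if "t \<in> {0..T}" for t
    using sums_unique2[OF g(1)[OF that] sums[OF that]] .
  have "(\<lambda>n. u n 0) sums y0"
  proof -
    have "u n 0 = (if n = 0 then y0 else 0)" for n
      by (cases n) (simp_all add: u0 uS)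
    then show ?thesis using sums_single[of 0 "\<lambda>_. y0"] by simp
  qed
  then have "g 0 = y0" using g(1)[of 0] T sums_unique2 by fastforce
  moreover have "(g has_vector_derivative F t (g t)) (at t within {0..T})" if "t \<in> {0..T}" for t
    using g(2)[OF that] gy[OF that] by (simp add: has_vector_derivative_def)
  ultimately show ?thesis by blast
qed

section \<open>Determinants and change of variables on Euclidean spaces\<close>

text \<open>
  The change of variables theorem of the library is stated for vectors over a well-ordered finite
  index type only; the basis vectors of an arbitrary Euclidean space, ordered arbitrarily, provide one.
\<close>

typedef (overloaded) ('a::euclidean_space) bix = "Basis :: 'a set"
  using nonempty_Basis by blast

instance bix :: (euclidean_space) finite
proof
  have "(UNIV :: 'a bix set) = Abs_bix ` Basis"
    by (metis type_definition.Abs_image type_definition_bix)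
  then show "finite (UNIV :: 'a bix set)" by (metis finite_Basis finite_imageI)
qed

instantiation bix :: (euclidean_space) wellorder
begin

definition less_eq_bix :: "'a bix \<Rightarrow> 'a bix \<Rightarrow> bool" where
  "less_eq_bix x y \<longleftrightarrow> to_nat_on UNIV x \<le> to_nat_on UNIV y"

definition less_bix :: "'a bix \<Rightarrow> 'a bix \<Rightarrow> bool" where
  "less_bix x y \<longleftrightarrow> to_nat_on UNIV x < to_nat_on UNIV y"

instance
proof
  fix x y :: "'a bix"
  show "x \<le> y \<Longrightarrow> y \<le> x \<Longrightarrow> x = y"
    using inj_on_to_nat_on[of "UNIV :: 'a bix set"]
    by (auto simp: less_eq_bix_def inj_on_def countable_finite)
  fix P :: "'a bix \<Rightarrow> bool" and a :: "'a bix"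
  assume step: "\<And>x. (\<And>y. y < x \<Longrightarrow> P y) \<Longrightarrow> P x"
  show "P a"
    by (rule measure_induct_rule[of "to_nat_on UNIV"], rule step) (simp add: less_bix_def)
qed (auto simp: less_eq_bix_def less_bix_def)

end

lemma bij_betw_Rep_bix: "bij_betw Rep_bix UNIV (Basis :: 'a::euclidean_space set)"
  by (simp add: bij_betw_def inj_def Rep_bix_inject type_definition.Rep_range[OF type_definition_bix])

lemma Rep_bix_Basis [simp]: "Rep_bix i \<in> Basis"
  by (rule Rep_bix)

lemma inner_Rep_bix: "Rep_bix i \<bullet> Rep_bix j = (if i = j then 1 else 0)"
  by (simp add: inner_Basis Rep_bix_inject)

definition coords :: "'a::euclidean_space \<Rightarrow> real ^ 'a bix" where
  "coords x = (\<chi> i. x \<bullet> Rep_bix i)"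

definition uncoords :: "real ^ 'a bix \<Rightarrow> 'a::euclidean_space" where
  "uncoords z = (\<Sum>i\<in>UNIV. z $ i *\<^sub>R Rep_bix i)"

lemma uncoords_inner_Rep: "uncoords z \<bullet> Rep_bix i = z $ i"
  by (simp add: uncoords_def inner_sum_left inner_Rep_bix if_distrib cong: if_cong)

lemma coords_uncoords [simp]: "coords (uncoords z) = z"
  by (simp add: coords_def uncoords_inner_Rep)

lemma uncoords_coords [simp]: "uncoords (coords x) = x"
proof -
  have "uncoords (coords x) = (\<Sum>b\<in>Basis. (x \<bullet> b) *\<^sub>R b)"
    unfolding uncoords_def coords_def by (simp add: sum.reindex_bij_betw[OF bij_betw_Rep_bix, of "\<lambda>b. (x \<bullet> b) *\<^sub>R b"])
  then show ?thesis by (simp add: euclidean_representation)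
qed

lemma bounded_linear_coords: "bounded_linear coords"
  by (rule linear_conv_bounded_linear[THEN iffD1], rule linearI)
    (simp_all add: coords_def inner_add_left vec_eq_iff)

lemma bounded_linear_uncoords: "bounded_linear uncoords"
  by (rule linear_conv_bounded_linear[THEN iffD1], rule linearI)
    (simp_all add: uncoords_def scaleR_add_left sum.distrib scaleR_sum_right)

lemma uncoords_vimage: "uncoords -` S = coords ` S"
  by (force simp: image_iff)

lemma uncoords_borel [measurable]: "uncoords \<in> borel_measurable borel"
  by (intro borel_measurable_continuous_onI linear_continuous_on bounded_linear_uncoords)

text \<open>Coordinates with respect to \<open>Basis\<close> match boxes with boxes of the same side
  lengths, and Lebesgue measure is determined by its values on boxes.\<close>

lemma distr_uncoords: "distr lborel borel uncoords = (lborel :: 'a::euclidean_space measure)"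
proof (rule sym, rule lborel_eqI)
  fix l u :: 'a assume le: "\<And>b. b \<in> Basis \<Longrightarrow> l \<bullet> b \<le> u \<bullet> b"
  have "uncoords -` box l u = box (coords l) (coords u)"
  proof (intro set_eqI iffI)
    fix z assume "z \<in> uncoords -` box l u"
    then have "\<And>b. b \<in> Basis \<Longrightarrow> l \<bullet> b < uncoords z \<bullet> b \<and> uncoords z \<bullet> b < u \<bullet> b"
      by (auto simp: mem_box)
    then have "l \<bullet> Rep_bix i < z $ i \<and> z $ i < u \<bullet> Rep_bix i" for i
      by (metis Rep_bix_Basis uncoords_inner_Rep)
    then show "z \<in> box (coords l) (coords u)" by (simp add: mem_box_cart coords_def)
  next
    fix z assume z: "z \<in> box (coords l) (coords u)"
    have "l \<bullet> b < uncoords z \<bullet> b \<and> uncoords z \<bullet> b < u \<bullet> b" if "b \<in> Basis" for b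
    proof -
      have "b \<in> range Rep_bix"
        using that bij_betw_imp_surj_on[OF bij_betw_Rep_bix] by blast
      then obtain i where "b = Rep_bix i" by blast
      with z show ?thesis by (simp add: mem_box_cart coords_def uncoords_inner_Rep)
    qed
    then show "z \<in> uncoords -` box l u" by (simp add: mem_box)
  qed
  then have "emeasure (distr lborel borel uncoords) (box l u) = emeasure lborel (box (coords l) (coords u))"
    by (simp add: emeasure_distr)
  also have "\<dots> = ennreal (\<Prod>b\<in>Basis. (coords u - coords l) \<bullet> b)"
  proof (rule emeasure_lborel_box)
    fix b :: "real ^ 'a bix" assume "b \<in> Basis"
    then show "coords l \<bullet> b \<le> coords u \<bullet> b"
      by (auto simp: Basis_vec_def inner_axis coords_def le)
  qed
  also have "(\<Prod>b\<in>Basis. (coords u - coords l) \<bullet> b) = (\<Prod>i\<in>UNIV. (coords u - coords l) $ i)"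
  proof -
    have "bij_betw (\<lambda>i. axis i 1) UNIV (Basis :: (real ^ 'a bix) set)"
      by (auto simp: Basis_vec_def bij_betw_def inj_def axis_eq_axis)
    from prod.reindex_bij_betw[OF this, of "\<lambda>b. (coords u - coords l) \<bullet> b"]
    show ?thesis by (simp add: inner_axis)
  qed
  also have "\<dots> = (\<Prod>i\<in>UNIV. (u - l) \<bullet> Rep_bix i)"
    by (simp add: coords_def inner_diff_left)
  also have "\<dots> = (\<Prod>b\<in>Basis. (u - l) \<bullet> b)"
    by (rule prod.reindex_bij_betw[OF bij_betw_Rep_bix])
  finally show "emeasure (distr lborel borel uncoords) (box l u) = ennreal (\<Prod>b\<in>Basis. (u - l) \<bullet> b)" .
qed simp

text \<open>For linear \<open>f\<close> this is the usual determinant: rows and columns are indexed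
  by the same enumeration of \<open>Basis\<close>, so the order chosen there cancels.\<close>

definition edet :: "('a::euclidean_space \<Rightarrow> 'a) \<Rightarrow> real" where
  "edet f = det (matrix (coords \<circ> f \<circ> uncoords))"

lemma edet_id: "edet (\<lambda>x. x) = 1"
  by (simp add: edet_def comp_def matrix_id_mat_1[unfolded id_def])

text \<open>Jacobi's formula. Differentiating one row at a time replaces row \<open>i\<close> of
  \<open>M t0\<close> by a combination of its rows; all terms but the one with coefficient
  \<open>B $ i $ i\<close> have a repeated row and vanish.\<close>

lemma has_real_derivative_det:
  fixes M :: "real \<Rightarrow> real ^ 'n ^ 'n" and B :: "real ^ 'n ^ 'n"
  assumes der: "\<And>i j. ((\<lambda>t. M t $ i $ j) has_real_derivative (B ** M t0) $ i $ j) (at t0 within S)"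
  shows "((\<lambda>t. det (M t)) has_real_derivative trace B * det (M t0)) (at t0 within S)"
proof -
  let ?N = "B ** M t0"
  let ?R = "\<lambda>i. \<chi> j. if j = i then ?N $ i else M t0 $ j"
  have row: "?N $ i = (\<Sum>k\<in>UNIV. B $ i $ k *s M t0 $ k)" for i
    by (simp add: vec_eq_iff matrix_matrix_mult_def)
  have "det (?R i) = B $ i $ i * det (M t0)" for i
  proof -
    have "det (?R i) = (\<Sum>k\<in>UNIV. det (\<chi> j. if j = i then B $ i $ k *s M t0 $ k else M t0 $ j))"
      unfolding row by (rule det_linear_row_sum) simp
    also have "\<dots> = (\<Sum>k\<in>UNIV. B $ i $ k * det (\<chi> j. if j = i then M t0 $ k else M t0 $ j))"
      by (simp add: det_row_mul)
    also have "\<dots> = (\<Sum>k\<in>UNIV. if k = i then B $ i $ i * det (M t0) else 0)"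
    proof (rule sum.cong[OF refl])
      fix k
      show "B $ i $ k * det (\<chi> j. if j = i then M t0 $ k else M t0 $ j) =
          (if k = i then B $ i $ i * det (M t0) else 0)"
      proof (cases "k = i")
        case True
        have "(\<chi> j. if j = i then M t0 $ i else M t0 $ j) = M t0" by (simp add: vec_eq_iff)
        with True show ?thesis by metis
      next
        case False
        have "det (\<chi> j. if j = i then M t0 $ k else M t0 $ j) = 0"
          by (rule det_identical_rows[OF False]) (simp add: row_def vec_eq_iff False)
        with False show ?thesis by simp
      qed
    qed
    finally show ?thesis by simp
  qed
  then have "trace B * det (M t0) = (\<Sum>i\<in>UNIV. det (?R i))"
    by (simp add: trace_def sum_distrib_right)
  also have "\<dots> = (\<Sum>i\<in>UNIV. \<Sum>p | p permutes UNIV. of_int (sign p) *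
      (?N $ i $ p i * (\<Prod>j\<in>UNIV - {i}. M t0 $ j $ p j)))"
    unfolding det_def
  proof (intro sum.cong refl, goal_cases)
    case (1 i p)
    have "(\<Prod>j\<in>UNIV. ?R i $ j $ p j) = ?R i $ i $ p i * (\<Prod>j\<in>UNIV - {i}. ?R i $ j $ p j)"
      by (rule prod.remove) auto
    also have "(\<Prod>j\<in>UNIV - {i}. ?R i $ j $ p j) = (\<Prod>j\<in>UNIV - {i}. M t0 $ j $ p j)"
      by (rule prod.cong) auto
    finally show ?case by simp
  qed
  also have "\<dots> = (\<Sum>p | p permutes UNIV. of_int (sign p) *
      (\<Sum>i\<in>UNIV. ?N $ i $ p i * (\<Prod>j\<in>UNIV - {i}. M t0 $ j $ p j)))"
    by (subst sum.swap) (simp add: sum_distrib_left)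
  finally have eq: "trace B * det (M t0) = \<dots>" .
  have "((\<lambda>t. \<Prod>i\<in>UNIV. M t $ i $ p i) has_real_derivative
      (\<Sum>i\<in>UNIV. ?N $ i $ p i * (\<Prod>j\<in>UNIV - {i}. M t0 $ j $ p j))) (at t0 within S)" for p
    unfolding has_field_derivative_def
    by (rule has_derivative_eq_rhs[OF has_derivative_prod], rule der[unfolded has_field_derivative_def])
      (simp add: fun_eq_iff sum_distrib_left mult_ac)
  then show ?thesis unfolding eq unfolding det_def
    by (intro DERIV_sum DERIV_cmult)
qed

text \<open>The infinitesimal Liouville formula: composition becomes a matrix product in
  coordinates, and the sum over \<open>Basis\<close> is the trace of \<open>A\<close>.\<close>

lemma has_real_derivative_edet:
  fixes J :: "real \<Rightarrow> 'a::euclidean_space \<Rightarrow>\<^sub>L 'a" and A :: "'a \<Rightarrow>\<^sub>L 'a"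
  assumes der: "(J has_vector_derivative A o\<^sub>L J t0) (at t0 within S)"
  shows "((\<lambda>t. edet (J t)) has_real_derivative (\<Sum>b\<in>Basis. A b \<bullet> b) * edet (J t0)) (at t0 within S)"
proof -
  define M where "M = (\<lambda>t. matrix (coords \<circ> blinfun_apply (J t) \<circ> uncoords))"
  define B where "B = matrix (coords \<circ> blinfun_apply A \<circ> uncoords)"
  have bl: "linear (coords \<circ> blinfun_apply F \<circ> uncoords)" for F :: "'a \<Rightarrow>\<^sub>L 'a"
    by (intro bounded_linear.linear linear_compose bounded_linear_coords bounded_linear_uncoords
        blinfun.bounded_linear_right)
  have un: "uncoords (axis j 1) = Rep_bix j" for j :: "'a bix"
    by (simp add: uncoords_def axis_def if_distrib[of "\<lambda>c. c *\<^sub>R _"] cong: if_cong)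
  have entry: "M t $ i $ j = J t (Rep_bix j) \<bullet> Rep_bix i" for t i j
    by (simp add: M_def matrix_def un coords_def)
  have "B ** M t0 = matrix ((coords \<circ> blinfun_apply A \<circ> uncoords) \<circ> (coords \<circ> blinfun_apply (J t0) \<circ> uncoords))"
    unfolding M_def B_def by (rule matrix_compose[symmetric]) (rule bl)+
  then have BM: "(B ** M t0) $ i $ j = A (J t0 (Rep_bix j)) \<bullet> Rep_bix i" for i j
    by (simp add: matrix_def un) (simp add: coords_def)
  have "((\<lambda>t. M t $ i $ j) has_real_derivative (B ** M t0) $ i $ j) (at t0 within S)" for i j
  proof -
    have "bounded_linear (\<lambda>F::'a \<Rightarrow>\<^sub>L 'a. F (Rep_bix j) \<bullet> Rep_bix i)"
      by (intro bounded_linear_intros)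
    from bounded_linear.has_vector_derivative[OF this der]
    show ?thesis unfolding entry BM by (simp add: has_real_derivative_iff_has_vector_derivative)
  qed
  then have "((\<lambda>t. det (M t)) has_real_derivative trace B * det (M t0)) (at t0 within S)"
    by (rule has_real_derivative_det)
  moreover have "trace B = (\<Sum>b\<in>Basis. A b \<bullet> b)"
    unfolding trace_def B_def
    by (simp add: matrix_def un coords_def sum.reindex_bij_betw[OF bij_betw_Rep_bix, of "\<lambda>b. A b \<bullet> b"])
  ultimately show ?thesis by (simp add: edet_def M_def)
qed

lemma nn_integral_uncoords:
  assumes "f \<in> borel_measurable borel"
  shows "(\<integral>\<^sup>+x. f x \<partial>lborel) = (\<integral>\<^sup>+z. f (uncoords z) \<partial>lborel)"
  by (subst distr_uncoords[symmetric]) (simp add: nn_integral_distr assms)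

text \<open>Passage from the gauge integral, in which the change of variables is available, to the
  measure integral; Borel measurability allows the completion of the measure to be dropped.\<close>

lemma nn_integral_lborel_eq_integral:
  fixes f :: "'a::euclidean_space \<Rightarrow> real"
  assumes int: "f absolutely_integrable_on S" and nonneg: "\<And>x. x \<in> S \<Longrightarrow> 0 \<le> f x"
    and meas: "(\<lambda>x. indicator S x * f x) \<in> borel_measurable borel"
  shows "(\<integral>\<^sup>+x. ennreal (indicator S x * f x) \<partial>lborel) = ennreal (integral S f)"
proof -
  have "integrable lborel (\<lambda>x. indicator S x * f x)"
    using int meas unfolding set_integrable_def by (simp add: integrable_completion)
  then have "(\<integral>\<^sup>+x. ennreal (indicator S x * f x) \<partial>lborel) = ennreal (LINT x|lborel. indicator S x * f x)"
    by (rule nn_integral_eq_integral) (auto simp: indicator_def nonneg)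
  also have "(LINT x|lborel. indicator S x * f x) = (LINT x:S|lebesgue. f x)"
    unfolding set_lebesgue_integral_def using meas by (simp add: integral_completion)
  also have "\<dots> = integral S f"
    by (rule set_lebesgue_integral_eq_integral[OF int])
  finally show ?thesis .
qed

lemma absolutely_integrable_on_nonneg_borel:
  fixes f :: "'a::euclidean_space \<Rightarrow> real"
  assumes nonneg: "\<And>x. x \<in> S \<Longrightarrow> 0 \<le> f x"
    and meas: "(\<lambda>x. indicator S x * f x) \<in> borel_measurable borel"
    and fin: "(\<integral>\<^sup>+x. ennreal (indicator S x * f x) \<partial>lborel) < \<infinity>"
  shows "f absolutely_integrable_on S"
proof -
  have "integrable lborel (\<lambda>x. indicator S x * f x)"
    using meas fin by (intro integrableI_nonneg) (auto simp: indicator_def nonneg)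
  then show ?thesis
    using meas unfolding set_integrable_def by (simp add: integrable_completion)
qed

text \<open>Conjugating by \<open>coords\<close> moves everything to Cartesian vectors without
  changing volumes. Finiteness of the right side supplies absolute integrability there, and the
  theorem transfers it, together with the value, to the image.\<close>

theorem nn_integral_change_of_variables:
  fixes g :: "'a::euclidean_space \<Rightarrow> 'a" and f :: "'a \<Rightarrow> real"
  assumes S: "S \<in> sets borel"
    and der: "\<And>x. x \<in> S \<Longrightarrow> (g has_derivative g' x) (at x within S)"
    and inj: "inj_on g S"
    and f0: "\<And>y. y \<in> g ` S \<Longrightarrow> 0 \<le> f y"
    and f: "(\<lambda>y. indicator (g ` S) y * f y) \<in> borel_measurable borel"
    and h: "(\<lambda>x. indicator S x * (\<bar>edet (g' x)\<bar> * f (g x))) \<in> borel_measurable borel"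
    and fin: "(\<integral>\<^sup>+x. ennreal (indicator S x * (\<bar>edet (g' x)\<bar> * f (g x))) \<partial>lborel) < \<infinity>"
  shows "(\<integral>\<^sup>+y. ennreal (indicator (g ` S) y * f y) \<partial>lborel) =
    (\<integral>\<^sup>+x. ennreal (indicator S x * (\<bar>edet (g' x)\<bar> * f (g x))) \<partial>lborel)"
proof -
  define S' where "S' = coords ` S"
  define G where "G = coords \<circ> g \<circ> uncoords"
  define G' where "G' = (\<lambda>z. coords \<circ> g' (uncoords z) \<circ> uncoords)"
  define F where "F = f \<circ> uncoords"
  define H where "H = (\<lambda>z. \<bar>det (matrix (G' z))\<bar> * F (G z))"
  have GS: "G ` S' = coords ` g ` S" by (simp add: G_def S'_def image_image)
  have ind: "indicator (coords ` A) z = (indicator A (uncoords z) :: real)" for A :: "'a set" and z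
    by (auto simp: indicator_def simp flip: uncoords_vimage)
  have H_eq: "indicator S' z * H z =
      (\<lambda>x. indicator S x * (\<bar>edet (g' x)\<bar> * f (g x))) (uncoords z)" for z
    by (simp add: S'_def ind H_def G'_def F_def G_def edet_def)
  have F_eq: "indicator (G ` S') z * F z = (\<lambda>y. indicator (g ` S) y * f y) (uncoords z)" for z
    by (simp add: GS ind F_def)
  have H_meas: "(\<lambda>z. indicator S' z * H z) \<in> borel_measurable borel"
    unfolding H_eq by (rule measurable_compose[OF uncoords_borel h])
  have F_meas: "(\<lambda>z. indicator (G ` S') z * F z) \<in> borel_measurable borel"
    unfolding F_eq by (rule measurable_compose[OF uncoords_borel f])
  have h_int: "(\<integral>\<^sup>+x. ennreal (indicator S x * (\<bar>edet (g' x)\<bar> * f (g x))) \<partial>lborel) =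
      (\<integral>\<^sup>+z. ennreal (indicator S' z * H z) \<partial>lborel)"
    unfolding H_eq using h by (intro nn_integral_uncoords) auto
  have f_int: "(\<integral>\<^sup>+y. ennreal (indicator (g ` S) y * f y) \<partial>lborel) =
      (\<integral>\<^sup>+z. ennreal (indicator (G ` S') z * F z) \<partial>lborel)"
    unfolding F_eq using f by (intro nn_integral_uncoords) auto
  have H0: "0 \<le> H z" if "z \<in> S'" for z
    using that f0 by (auto simp: H_def F_def G_def S'_def)
  have F0: "0 \<le> F z" if "z \<in> G ` S'" for z
    using that f0 by (auto simp: GS F_def)
  have S'_leb: "S' \<in> sets lebesgue"
    using measurable_sets[OF uncoords_borel S] by (simp add: S'_def uncoords_vimage)
  have H_abs: "H absolutely_integrable_on S'"
    using H0 H_meas fin unfolding h_int by (intro absolutely_integrable_on_nonneg_borel)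
  have derG: "(G has_derivative G' z) (at z within S')" if "z \<in> S'" for z
  proof -
    have "uncoords ` S' = S" by (simp add: S'_def image_image)
    then have "(g has_derivative g' (uncoords z)) (at (uncoords z) within uncoords ` S')"
      using der that by auto
    moreover have "(uncoords has_derivative uncoords) (at z within S')"
      by (rule bounded_linear_imp_has_derivative[OF bounded_linear_uncoords])
    ultimately have "(g \<circ> uncoords has_derivative g' (uncoords z) \<circ> uncoords) (at z within S')"
      by (intro diff_chain_within)
    then show ?thesis
      unfolding G_def G'_def comp_assoc
      using bounded_linear.has_derivative[OF bounded_linear_coords] by (simp add: comp_def)
  qed
  have injG: "inj_on G S'"
    using inj by (auto simp: G_def S'_def inj_on_def) (metis uncoords_coords)
  \<comment> \<open>The Cartesian theorem concerns vector-valued integrands, so the real integrand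
    is regarded as a vector with one component.\<close>
  let ?v = "vec :: real \<Rightarrow> real ^ 1"
  have "(\<lambda>z. \<bar>det (matrix (G' z))\<bar> *\<^sub>R ?v (F (G z))) absolutely_integrable_on S' \<and>
        integral S' (\<lambda>z. \<bar>det (matrix (G' z))\<bar> *\<^sub>R ?v (F (G z))) = ?v (integral S' H) \<longleftrightarrow>
      (\<lambda>z. ?v (F z)) absolutely_integrable_on (G ` S') \<and> integral (G ` S') (\<lambda>z. ?v (F z)) = ?v (integral S' H)"
    by (rule has_absolute_integral_change_of_variables[OF S'_leb derG injG])
  then have "F absolutely_integrable_on (G ` S') \<and> integral (G ` S') F = integral S' H"
    using H_abs by (simp add: absolutely_integrable_on_1_iff integral_on_1_eq H_def vec_eq_iff)
  then show ?thesis unfolding f_int h_int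
    using nn_integral_lborel_eq_integral[OF _ F0 F_meas] nn_integral_lborel_eq_integral[OF H_abs H0 H_meas]
    by simp
qed

section \<open>Flows of tangential vector fields\<close>

text \<open>A ball is connected, so if it meets \<open>S\<close> and leaves it, it meets the
  frontier; but no frontier point is closer to \<open>y\<close> than the radius.\<close>

lemma ball_infdist_frontier_subset:
  fixes y :: "'a::euclidean_space"
  assumes "y \<in> S" shows "ball y (infdist y (frontier S)) \<subseteq> S"
proof (rule ccontr)
  let ?B = "ball y (infdist y (frontier S))"
  assume n: "\<not> ?B \<subseteq> S"
  then have "y \<in> ?B \<inter> S" using assms by (auto intro: le_less_trans[OF zero_le_dist])
  with n have "?B \<inter> frontier S \<noteq> {}"
    by (intro connected_Int_frontier connected_ball) blast+
  then show False using infdist_le[of _ "frontier S" y] by (force simp: not_less)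
qed

text \<open>Tangency is phrased through nearest boundary points: \<open>y - z\<close> stands for the
  normal at \<open>z\<close>. Thus the locale needs no description of the boundary, and the
  condition has exactly the form in which \<open>bdist_dini\<close> consumes it. Derivatives of
  \<open>v\<close> are asked for in the open domain only.\<close>

locale tangential_flow =
  fixes \<Omega> :: "'a::euclidean_space set"
    and v :: "real \<Rightarrow> 'a \<Rightarrow> 'a" and Dv :: "real \<Rightarrow> 'a \<Rightarrow> 'a \<Rightarrow>\<^sub>L 'a"
    and X :: "real \<Rightarrow> 'a \<Rightarrow> 'a"
  assumes open_dom: "open \<Omega>" and conn_dom: "connected \<Omega>"
    and bounded_dom: "bounded \<Omega>" and nonempty_dom: "\<Omega> \<noteq> {}"
    and v_cont: "\<And>t. 0 \<le> t \<Longrightarrow> continuous_on (closure \<Omega>) (v t)"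
    and v_der: "\<And>t y. 0 \<le> t \<Longrightarrow> y \<in> \<Omega> \<Longrightarrow> (v t has_derivative Dv t y) (at y)"
    and Dv_cont: "continuous_on ({0..} \<times> \<Omega>) (\<lambda>(t, y). Dv t y)"
    and Dv_bounded: "\<And>T. \<exists>L. \<forall>t\<in>{0..T}. \<forall>y\<in>\<Omega>. norm (Dv t y) \<le> L"
    and tangent: "\<And>t y z. 0 \<le> t \<Longrightarrow> y \<in> \<Omega> \<Longrightarrow> z \<in> frontier \<Omega> \<Longrightarrow>
      dist y z = infdist y (frontier \<Omega>) \<Longrightarrow> v t z \<bullet> (y - z) = 0"
    and X_closure: "\<And>t x. 0 \<le> t \<Longrightarrow> x \<in> closure \<Omega> \<Longrightarrow> X t x \<in> closure \<Omega>"
    and X_0: "\<And>x. x \<in> closure \<Omega> \<Longrightarrow> X 0 x = x"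
    and X_der: "\<And>t x. 0 \<le> t \<Longrightarrow> x \<in> closure \<Omega> \<Longrightarrow>
      ((\<lambda>s. X s x) has_vector_derivative v t (X t x)) (at t within {0..})"
begin

section \<open>Distance of a trajectory to the boundary and invariance of the domain\<close>

abbreviation bdist :: "'a \<Rightarrow> real" where
  "bdist y \<equiv> infdist y (frontier \<Omega>)"

lemma dom_closure: "x \<in> \<Omega> \<Longrightarrow> x \<in> closure \<Omega>"
  using closure_subset by blast

lemma frontier_nonempty: "frontier \<Omega> \<noteq> {}"
  using nonempty_dom bounded_dom by (auto simp: frontier_eq_empty)

lemma bdist_pos_iff: "y \<in> closure \<Omega> \<Longrightarrow> 0 < bdist y \<longleftrightarrow> y \<in> \<Omega>"
  using in_closed_iff_infdist_zero[OF frontier_closed frontier_nonempty, of y] infdist_nonneg[of y "frontier \<Omega>"]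
    open_dom by (auto simp: frontier_def interior_open less_le)

lemma nearest_boundary_point:
  obtains z where "z \<in> frontier \<Omega>" "dist y z = bdist y"
  using infdist_attains_inf[OF frontier_closed frontier_nonempty, of y] by metis

text \<open>The mean value inequality holds on the convex open ball and passes to the closed one by
  continuity of \<open>v t\<close> up to the boundary. The closed ball matters because a nearest
  boundary point lies on its sphere.\<close>

lemma v_lipschitz_ball:
  assumes t: "0 \<le> t" and L: "\<And>y. y \<in> \<Omega> \<Longrightarrow> norm (Dv t y) \<le> L" and sub: "ball y r \<subseteq> \<Omega>"
    and r: "0 < r"
  shows "L-lipschitz_on (cball y r) (v t)"
proof -
  have "y \<in> \<Omega>" using sub r by auto
  then have L0: "0 \<le> L" using L[of y] norm_ge_zero order_trans by blast
  have "L-lipschitz_on (ball y r) (v t)"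
  proof (rule bounded_derivative_imp_lipschitz)
    fix x assume "x \<in> ball y r"
    then have x: "x \<in> \<Omega>" using sub by blast
    show "(v t has_derivative Dv t x) (at x within ball y r)"
      using v_der[OF t x] by (rule has_derivative_at_withinI)
    show "onorm (Dv t x) \<le> L" using L[OF x] by (simp add: norm_blinfun.rep_eq)
  qed (use L0 in auto)
  moreover have "continuous_on (closure (ball y r)) (v t)"
    using closure_mono[OF sub] by (rule continuous_on_subset[OF v_cont[OF t]])
  ultimately show ?thesis
    using lipschitz_on_closure r by (metis closure_ball less_irrefl)
qed

lemma X_continuous: "x \<in> closure \<Omega> \<Longrightarrow> continuous_on {0..} (\<lambda>s. X s x)"
  by (rule continuous_on_vector_derivative[where f' = "\<lambda>t. v t (X t x)"]) (simp add: X_der)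

lemma X_der_Icc:
  "x \<in> closure \<Omega> \<Longrightarrow> t \<in> {0..T} \<Longrightarrow>
    ((\<lambda>s. X s x) has_vector_derivative v t (X t x)) (at t within {0..T})"
  by (rule has_vector_derivative_within_subset[OF X_der]) auto

text \<open>Freeze a boundary point \<open>z\<close> nearest to \<open>X t x\<close>. Then
  \<open>norm (X s x - z)\<close> dominates the boundary distance, agrees with it at
  \<open>s = t\<close>, and is differentiable there; by \<open>tangent\<close> only
  \<open>v t (X t x) - v t z\<close> contributes to its slope. The bound covers both
  \<open>s > t\<close> and \<open>s < t\<close>, hence serves in both time directions.\<close>

lemma bdist_dini:
  assumes t: "0 \<le> t" and L: "\<And>y. y \<in> \<Omega> \<Longrightarrow> norm (Dv t y) \<le> L"
    and x: "x \<in> closure \<Omega>" and y: "X t x \<in> \<Omega>" and \<epsilon>: "0 < \<epsilon>"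
  shows "\<forall>\<^sub>F s in at t within {0..}. bdist (X s x) \<le> bdist (X t x) + (L * bdist (X t x) + \<epsilon>) * \<bar>s - t\<bar>"
proof -
  let ?y = "X t x"
  obtain z where z: "z \<in> frontier \<Omega>" "dist ?y z = bdist ?y" using nearest_boundary_point .
  have d: "0 < bdist ?y" using y bdist_pos_iff dom_closure by blast
  have "dist (v t ?y) (v t z) \<le> L * dist ?y z"
    using z d by (intro lipschitz_onD[OF v_lipschitz_ball[OF t L ball_infdist_frontier_subset[OF y] d]]) auto
  then have diff: "norm (v t ?y - v t z) \<le> L * bdist ?y" using z by (simp add: dist_norm)
  have nz: "?y - z \<noteq> 0" using z d by auto
  have "((\<lambda>s. norm (X s x - z)) has_derivative (\<lambda>h. (h *\<^sub>R v t ?y) \<bullet> sgn (?y - z))) (at t within {0..})"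
    using has_derivative_compose[OF
        X_der[OF t x, unfolded has_vector_derivative_def, THEN has_derivative_diff, OF has_derivative_const, of z]
        has_derivative_norm[OF nz]]
    by simp
  then have "\<forall>\<^sub>F s in at t within {0..}.
      norm (norm (X s x - z) - norm (?y - z) - ((s - t) *\<^sub>R v t ?y) \<bullet> sgn (?y - z)) \<le> \<epsilon> * norm (s - t)"
    using \<epsilon> by (simp add: has_derivative_within_alt2)
  then show ?thesis
  proof eventually_elim
    case (elim s)
    have "v t ?y \<bullet> sgn (?y - z) = (v t ?y - v t z) \<bullet> sgn (?y - z)"
      using tangent[OF t y z] by (simp add: inner_diff_left sgn_div_norm)
    also have "\<bar>\<dots>\<bar> \<le> norm (v t ?y - v t z) * norm (sgn (?y - z))" by (rule Cauchy_Schwarz_ineq2)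
    also have "\<dots> \<le> L * bdist ?y" using diff nz by (simp add: norm_sgn)
    finally have "\<bar>v t ?y \<bullet> sgn (?y - z)\<bar> \<le> L * bdist ?y" .
    then have "\<bar>((s - t) *\<^sub>R v t ?y) \<bullet> sgn (?y - z)\<bar> \<le> \<bar>s - t\<bar> * (L * bdist ?y)"
      by (simp add: abs_mult mult_left_mono)
    moreover have "bdist (X s x) \<le> norm (X s x - z)"
      using infdist_le[OF z(1), of "X s x"] by (simp add: dist_norm)
    moreover have "norm (?y - z) = bdist ?y" using z by (simp add: dist_norm)
    ultimately show ?case using elim by (simp add: algebra_simps)
  qed
qed

lemma bdist_X_continuous: "x \<in> closure \<Omega> \<Longrightarrow> continuous_on {0..} (\<lambda>s. bdist (X s x))"
  by (intro continuous_intros X_continuous)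

text \<open>Gronwall along the reversed trajectory: growth backwards in time is at most exponential,
  so decay forwards is too. Staying in \<Omega> up to time \<open>b\<close> is a premise, since
  invariance is only deduced from this bound.\<close>

lemma bdist_lower:
  assumes b: "0 \<le> b" "b \<le> T" and L0: "0 \<le> L" and L: "\<And>t y. t \<in> {0..T} \<Longrightarrow> y \<in> \<Omega> \<Longrightarrow> norm (Dv t y) \<le> L"
    and x: "x \<in> closure \<Omega>" and y: "\<And>s. s \<in> {0..b} \<Longrightarrow> X s x \<in> \<Omega>"
  shows "bdist x \<le> bdist (X b x) * exp (L * b)"
proof -
  have "bdist (X (b - b) x) \<le> (bdist (X (b - 0) x) + 0 * (b - 0)) * exp (L * (b - 0))"
  \<comment> \<open>The Dini bound is available at all times in question, so \<delta> is simply put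
    one above the resulting estimate.\<close>
  proof (rule dini_gronwall[where f = "\<lambda>s. bdist (X (b - s) x)" and \<delta> = "bdist (X b x) * exp (L * b) + 1" and a = 0 and b = b])
    show "continuous_on {0..b} (\<lambda>s. bdist (X (b - s) x))"
      by (rule continuous_on_compose2[OF bdist_X_continuous[OF x]]) (auto intro!: continuous_intros)
    fix t \<epsilon> :: real assume t: "t \<in> {0..<b}" and \<epsilon>: "0 < \<epsilon>"
    have "\<forall>\<^sub>F s in at (b - t) within {0..}. bdist (X s x) \<le> bdist (X (b - t) x) +
        (L * bdist (X (b - t) x) + \<epsilon>) * \<bar>s - (b - t)\<bar>"
      using t \<epsilon> b x by (intro bdist_dini L y) auto
    moreover have "filterlim (\<lambda>s. b - s) (at (b - t) within {0..}) (at_right t)"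
      unfolding filterlim_at
    proof
      show "((\<lambda>s. b - s) \<longlongrightarrow> b - t) (at_right t)" by (intro tendsto_intros)
      have "\<forall>\<^sub>F s in at_right t. s \<in> {t<..<b}" using t by (auto intro: eventually_at_rightI)
      then show "\<forall>\<^sub>F s in at_right t. b - s \<in> {0..} \<and> b - s \<noteq> b - t"
        by eventually_elim auto
    qed
    ultimately have "\<forall>\<^sub>F s in at_right t. bdist (X (b - s) x) \<le> bdist (X (b - t) x) +
        (L * bdist (X (b - t) x) + \<epsilon>) * \<bar>(b - s) - (b - t)\<bar>"
      by (auto simp: filterlim_iff)
    then show "\<forall>\<^sub>F s in at_right t. bdist (X (b - s) x) \<le> bdist (X (b - t) x) +
        (L * bdist (X (b - t) x) + 0 + \<epsilon>) * (s - t)"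
      using eventually_at_right_less by eventually_elim simp
  qed (use b L0 infdist_nonneg in auto)
  then show ?thesis using X_0[OF x] by simp
qed

lemma Dv_bound_nonneg: obtains L where "0 \<le> L" "\<And>t y. t \<in> {0..T} \<Longrightarrow> y \<in> \<Omega> \<Longrightarrow> norm (Dv t y) \<le> L"
proof -
  obtain L where "\<forall>t\<in>{0..T}. \<forall>y\<in>\<Omega>. norm (Dv t y) \<le> L" using Dv_bounded by blast
  then have "\<And>t y. t \<in> {0..T} \<Longrightarrow> y \<in> \<Omega> \<Longrightarrow> norm (Dv t y) \<le> max 0 L" by fastforce
  then show ?thesis using that[of "max 0 L"] by simp
qed

text \<open>At a first exit time the boundary distance would vanish, while the lower bound
  \<open>bdist_lower\<close>, valid at all earlier times, passes to the limit and keeps it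
  positive.\<close>

lemma X_in_dom:
  assumes x: "x \<in> \<Omega>" and t: "0 \<le> t"
  shows "X t x \<in> \<Omega>"
proof (rule ccontr)
  assume neg: "X t x \<notin> \<Omega>"
  note xc = dom_closure[OF x]
  obtain L where L0: "0 \<le> L" and L: "\<And>s y. s \<in> {0..t} \<Longrightarrow> y \<in> \<Omega> \<Longrightarrow> norm (Dv s y) \<le> L"
    using Dv_bound_nonneg[of t] by metis
  define S where "S = {s \<in> {0..t}. bdist (X s x) \<le> 0}"
  have S_iff: "s \<in> S \<longleftrightarrow> s \<in> {0..t} \<and> X s x \<notin> \<Omega>" for s
    using bdist_pos_iff[OF X_closure[OF _ xc]] by (auto simp: S_def not_less[symmetric])
  have "closed S" unfolding S_def
    using continuous_on_subset[OF bdist_X_continuous[OF xc], of "{0..t}"]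
    by (intro continuous_on_closed_Collect_le) auto
  moreover have "t \<in> S" using t neg by (simp add: S_iff)
  moreover have bdd: "bdd_below S" by (auto simp: S_def)
  ultimately have "Inf S \<in> S" using closed_contains_Inf by blast
  define t0 where "t0 = Inf S"
  have t0: "t0 \<in> {0..t}" "bdist (X t0 x) \<le> 0" using \<open>Inf S \<in> S\<close> by (auto simp: S_def t0_def)
  have x0: "0 < bdist x" using bdist_pos_iff xc x by blast
  have "t0 \<noteq> 0" using t0 x0 X_0[OF xc] by auto
  then have pos: "0 < t0" using t0 by auto
  have before: "X s x \<in> \<Omega>" if "s \<in> {0..<t0}" for s
    using cInf_lower[OF _ bdd, of s] that t0 S_iff[of s] by (force simp: t0_def)
  have "\<forall>\<^sub>F b in at_left t0. bdist x \<le> bdist (X b x) * exp (L * b)"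
  proof -
    have "\<forall>\<^sub>F b in at_left t0. b \<in> {0<..<t0}" using pos by (auto intro: eventually_at_leftI)
    then show ?thesis
      by eventually_elim (use t0 L0 in \<open>auto intro!: bdist_lower[of _ t] L xc before\<close>)
  qed
  moreover have "((\<lambda>b. bdist (X b x) * exp (L * b)) \<longlongrightarrow> bdist (X t0 x) * exp (L * t0)) (at_left t0)"
  proof -
    have "continuous_on {0..t0} (\<lambda>b. bdist (X b x) * exp (L * b))"
      by (intro continuous_intros continuous_on_subset[OF X_continuous[OF xc]]) auto
    then show ?thesis
      using pos by (auto simp: continuous_on_def at_within_Icc_at_left dest!: bspec[of _ _ t0])
  qed
  ultimately have "bdist x \<le> bdist (X t0 x) * exp (L * t0)"
    by (intro tendsto_lowerbound) auto
  also have "\<dots> \<le> 0" using t0 by (simp add: mult_nonpos_nonneg)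
  finally show False using x0 by simp
qed

text \<open>The forward counterpart of \<open>bdist_lower\<close>: points starting near the boundary
  stay near it. It serves to show that preimages of an interior point cannot accumulate at the
  boundary.\<close>

lemma bdist_upper:
  assumes t: "t \<in> {0..T}" and L0: "0 \<le> L" and L: "\<And>t y. t \<in> {0..T} \<Longrightarrow> y \<in> \<Omega> \<Longrightarrow> norm (Dv t y) \<le> L"
    and x: "x \<in> \<Omega>"
  shows "bdist (X t x) \<le> bdist x * exp (L * t)"
proof -
  note xc = dom_closure[OF x]
  have "bdist (X t x) \<le> (bdist (X 0 x) + 0 * (t - 0)) * exp (L * (t - 0))"
  proof (rule dini_gronwall[where f = "\<lambda>s. bdist (X s x)" and \<delta> = "bdist x * exp (L * T) + 1" and a = 0 and b = T])
    show "continuous_on {0..T} (\<lambda>s. bdist (X s x))"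
      by (rule continuous_on_subset[OF bdist_X_continuous[OF xc]]) auto
    fix s \<epsilon> :: real assume s: "s \<in> {0..<T}" and \<epsilon>: "0 < \<epsilon>"
    have "\<forall>\<^sub>F r in at s within {0..}. bdist (X r x) \<le> bdist (X s x) + (L * bdist (X s x) + \<epsilon>) * \<bar>r - s\<bar>"
      using s \<epsilon> x xc by (intro bdist_dini L X_in_dom) auto
    then have "\<forall>\<^sub>F r in at_right s. bdist (X r x) \<le> bdist (X s x) + (L * bdist (X s x) + \<epsilon>) * \<bar>r - s\<bar>"
      by (rule filter_leD[OF at_le, rotated]) (use s in auto)
    then show "\<forall>\<^sub>F r in at_right s. bdist (X r x) \<le> bdist (X s x) + (L * bdist (X s x) + 0 + \<epsilon>) * (r - s)"
      using eventually_at_right_less by eventually_elim simp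
  qed (use t L0 infdist_nonneg X_0[OF xc] in auto)
  then show ?thesis using X_0[OF xc] by simp
qed

text \<open>The radius is half of the lower bound that \<open>bdist_lower\<close> gives uniformly on
  \<open>{0..T}\<close>; halving makes room for closed balls.\<close>

lemma trajectory_tube:
  assumes x: "x \<in> \<Omega>"
  obtains r where "0 < r" "\<And>t. t \<in> {0..T} \<Longrightarrow> cball (X t x) r \<subseteq> \<Omega>"
proof -
  note xc = dom_closure[OF x]
  obtain L where L0: "0 \<le> L" and L: "\<And>s y. s \<in> {0..T} \<Longrightarrow> y \<in> \<Omega> \<Longrightarrow> norm (Dv s y) \<le> L"
    using Dv_bound_nonneg[of T] by metis
  define r where "r = bdist x * exp (- (L * T)) / 2"
  have x0: "0 < bdist x" using bdist_pos_iff xc x by blast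
  show ?thesis
  proof
    show "0 < r" using x0 by (simp add: r_def)
    fix t assume t: "t \<in> {0..T}"
    have "bdist x \<le> bdist (X t x) * exp (L * t)"
      using t by (intro bdist_lower[of _ T] L0 L xc X_in_dom x) auto
    also have "\<dots> \<le> bdist (X t x) * exp (L * T)"
      using t L0 by (intro mult_left_mono infdist_nonneg) (auto intro: mult_left_mono)
    finally have "2 * r \<le> bdist (X t x)" by (simp add: r_def exp_minus field_simps)
    then have "r < bdist (X t x)" using \<open>0 < r\<close> by simp
    then show "cball (X t x) r \<subseteq> \<Omega>"
      using ball_infdist_frontier_subset[OF X_in_dom[OF x]] t by fastforce
  qed
qed

section \<open>The flow map as a homeomorphism of the domain\<close>

text \<open>The velocity is Lipschitz only within the tube, so the tube radius is the Gronwall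
  threshold; the smallness of \<open>norm (y - x)\<close> keeps the second trajectory
  inside.\<close>

lemma X_lipschitz_local:
  assumes x: "x \<in> \<Omega>" and L0: "0 \<le> L" and L: "\<And>t y. t \<in> {0..T} \<Longrightarrow> y \<in> \<Omega> \<Longrightarrow> norm (Dv t y) \<le> L"
    and r: "0 < r" "\<And>t. t \<in> {0..T} \<Longrightarrow> cball (X t x) r \<subseteq> \<Omega>"
    and y: "y \<in> \<Omega>" "norm (y - x) * exp (L * T) < r" and t: "t \<in> {0..T}"
  shows "norm (X t y - X t x) \<le> norm (y - x) * exp (L * t)"
proof -
  have "norm (X t y - X t x) \<le> (norm (X 0 y - X 0 x) + 0 * (t - 0)) * exp (L * (t - 0))"
  proof (rule norm_gronwall[where y = "\<lambda>s. X s y - X s x" and y' = "\<lambda>s. v s (X s y) - v s (X s x)"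
        and \<delta> = r and a = 0 and b = T])
    show "((\<lambda>s. X s y - X s x) has_vector_derivative v s (X s y) - v s (X s x)) (at s within {0..T})"
      if "s \<in> {0..T}" for s
      using that by (intro has_vector_derivative_diff X_der_Icc dom_closure x y)
    fix s assume s: "s \<in> {0..T}" and lt: "norm (X s y - X s x) < r"
    have lip: "L-lipschitz_on (cball (X s x) r) (v s)"
    proof (rule v_lipschitz_ball)
      show "ball (X s x) r \<subseteq> \<Omega>" using r(2)[OF s] ball_subset_cball[of "X s x" r] by blast
    qed (use s r L in auto)
    have "X s y \<in> cball (X s x) r" using lt by (simp add: dist_norm norm_minus_commute)
    then show "norm (v s (X s y) - v s (X s x)) \<le> L * norm (X s y - X s x) + 0"
      using lipschitz_onD[OF lip, of "X s y" "X s x"] r(1) by (simp add: dist_norm)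
  qed (use y t L0 X_0 dom_closure x in auto)
  then show ?thesis using X_0 dom_closure x y by simp
qed

lemma X_continuous_dom:
  assumes t: "0 \<le> t" shows "continuous_on \<Omega> (X t)"
  unfolding continuous_on_eq_continuous_at[OF open_dom]
proof
  fix x assume x: "x \<in> \<Omega>"
  obtain L where L0: "0 \<le> L" and L: "\<And>s y. s \<in> {0..t} \<Longrightarrow> y \<in> \<Omega> \<Longrightarrow> norm (Dv s y) \<le> L"
    using Dv_bound_nonneg[of t] by metis
  obtain r where r: "0 < r" "\<And>s. s \<in> {0..t} \<Longrightarrow> cball (X s x) r \<subseteq> \<Omega>"
    using trajectory_tube[OF x, of t] by metis
  have "((\<lambda>y. norm (y - x) * exp (L * t)) \<longlongrightarrow> norm (x - x) * exp (L * t)) (at x)"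
    by (intro tendsto_intros)
  then have lim: "((\<lambda>y. norm (y - x) * exp (L * t)) \<longlongrightarrow> 0) (at x)" by simp
  have "\<forall>\<^sub>F y in at x. y \<in> \<Omega>" using open_dom x by (rule eventually_at_in_open')
  then have "\<forall>\<^sub>F y in at x. norm (X t y - X t x) \<le> norm (y - x) * exp (L * t)"
    using order_tendstoD(2)[OF lim r(1)]
    by eventually_elim (use t in \<open>auto intro!: X_lipschitz_local[OF x L0 L r]\<close>)
  then have "((\<lambda>y. X t y - X t x) \<longlongrightarrow> 0) (at x)"
    by (rule Lim_null_comparison[OF _ lim])
  then show "isCont (X t) x" by (simp add: isCont_def LIM_zero_iff)
qed

text \<open>Two trajectories that meet at time \<open>t\<close> are compared backwards from there:
  their difference starts at zero, so Gronwall in the tube around one of them keeps it zero down to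
  time 0.\<close>

lemma X_inj:
  assumes t: "0 \<le> t" shows "inj_on (X t) \<Omega>"
proof (rule inj_onI)
  fix y x assume y: "y \<in> \<Omega>" and x: "x \<in> \<Omega>" and eq: "X t y = X t x"
  obtain L where L0: "0 \<le> L" and L: "\<And>s y. s \<in> {0..t} \<Longrightarrow> y \<in> \<Omega> \<Longrightarrow> norm (Dv s y) \<le> L"
    using Dv_bound_nonneg[of t] by metis
  obtain r where r: "0 < r" "\<And>s. s \<in> {0..t} \<Longrightarrow> cball (X s x) r \<subseteq> \<Omega>"
    using trajectory_tube[OF x, of t] by metis
  have "norm (X (t - t) y - X (t - t) x) \<le> (norm (X (t - 0) y - X (t - 0) x) + 0 * (t - 0)) * exp (L * (t - 0))"
  proof (rule norm_gronwall[where y = "\<lambda>s. X (t - s) y - X (t - s) x"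
        and y' = "\<lambda>s. - (v (t - s) (X (t - s) y) - v (t - s) (X (t - s) x))" and \<delta> = r and a = 0 and b = t])
    show "((\<lambda>s. X (t - s) y - X (t - s) x) has_vector_derivative
        - (v (t - s) (X (t - s) y) - v (t - s) (X (t - s) x))) (at s within {0..t})"
      if s: "s \<in> {0..t}" for s
    proof -
      have im: "(\<lambda>s. t - s) ` {0..t} = {0..t}" by (force simp: image_iff intro: bexI[of _ "t - _"])
      have 1: "((\<lambda>u. X u y - X u x) has_vector_derivative v (t - s) (X (t - s) y) - v (t - s) (X (t - s) x))
          (at (t - s) within (\<lambda>s. t - s) ` {0..t})"
        unfolding im using s by (intro has_vector_derivative_diff X_der_Icc dom_closure x y) auto
      have 2: "((\<lambda>s. t - s) has_vector_derivative - 1) (at s within {0..t})"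
        by (auto intro!: derivative_eq_intros)
      show ?thesis using vector_diff_chain_within[OF 2 1] by (simp add: o_def)
    qed
    fix s assume s': "s \<in> {0..t}" and lt: "norm (X (t - s) y - X (t - s) x) < r"
    then have s: "t - s \<in> {0..t}" by simp
    have lip: "L-lipschitz_on (cball (X (t - s) x) r) (v (t - s))"
    proof (rule v_lipschitz_ball)
      show "ball (X (t - s) x) r \<subseteq> \<Omega>" using r(2)[OF s] ball_subset_cball[of "X (t - s) x" r] by blast
    qed (use s r L in auto)
    have "X (t - s) y \<in> cball (X (t - s) x) r" using lt by (simp add: dist_norm norm_minus_commute)
    then have "norm (v (t - s) (X (t - s) y) - v (t - s) (X (t - s) x)) \<le> L * norm (X (t - s) y - X (t - s) x)"
      using lipschitz_onD[OF lip, of "X (t - s) y" "X (t - s) x"] r(1) by (simp add: dist_norm)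
    then show "norm (- (v (t - s) (X (t - s) y) - v (t - s) (X (t - s) x))) \<le> L * norm (X (t - s) y - X (t - s) x) + 0"
      by (simp only: norm_minus_cancel add_0_right)
  qed (use eq t L0 r in auto)
  then show "y = x" using eq X_0 dom_closure x y by simp
qed

text \<open>
  The image is open by invariance of domain and closed relative to the domain because the distance to
  the boundary grows at most by the factor \<open>exp (L t)\<close>; connectedness does the rest.
\<close>

lemma X_image:
  assumes t: "0 \<le> t" shows "X t ` \<Omega> = \<Omega>"
proof -
  obtain L where L0: "0 \<le> L" and L: "\<And>s y. s \<in> {0..t} \<Longrightarrow> y \<in> \<Omega> \<Longrightarrow> norm (Dv s y) \<le> L"
    using Dv_bound_nonneg[of t] by metis
  have sub: "X t ` \<Omega> \<subseteq> \<Omega>" using X_in_dom t by blast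
  have op: "open (X t ` \<Omega>)"
    by (rule invariance_of_domain[OF X_continuous_dom[OF t] open_dom X_inj[OF t]])
  have cl: "closure (X t ` \<Omega>) \<inter> \<Omega> \<subseteq> X t ` \<Omega>"
  proof
    fix y assume y: "y \<in> closure (X t ` \<Omega>) \<inter> \<Omega>"
    then have "\<exists>w. (\<forall>n. w n \<in> X t ` \<Omega>) \<and> w \<longlonglongrightarrow> y" by (simp add: closure_sequential)
    then obtain w where w: "\<And>n. w n \<in> X t ` \<Omega>" "w \<longlonglongrightarrow> y" by blast
    have "\<forall>n. \<exists>u. u \<in> \<Omega> \<and> w n = X t u" using w(1) by blast
    then obtain u where u: "\<And>n. u n \<in> \<Omega>" "\<And>n. w n = X t (u n)" by metis
    have "compact (closure \<Omega>)" using bounded_dom by (simp add: compact_closure)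
    moreover have "\<forall>n. u n \<in> closure \<Omega>" using u(1) dom_closure by blast
    ultimately obtain x \<sigma> where x: "x \<in> closure \<Omega>" and \<sigma>: "strict_mono (\<sigma> :: nat \<Rightarrow> nat)" and lim: "(u \<circ> \<sigma>) \<longlonglongrightarrow> x"
      unfolding compact_def by blast
    have "(\<lambda>n. bdist (w (\<sigma> n))) \<longlonglongrightarrow> bdist y"
      using LIMSEQ_subseq_LIMSEQ[OF w(2) \<sigma>] by (intro tendsto_intros) (simp add: o_def)
    moreover have "(\<lambda>n. bdist (u (\<sigma> n)) * exp (L * t)) \<longlonglongrightarrow> bdist x * exp (L * t)"
      using lim by (intro tendsto_intros) (simp add: o_def)
    \<comment> \<open>The limit \<open>x\<close> of the preimages is so far known only to lie in the
      closure. Since \<open>y\<close> has positive boundary distance, this inequality puts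
      \<open>x\<close> into \<Omega>.\<close>
    ultimately have "bdist y \<le> bdist x * exp (L * t)"
      by (rule LIMSEQ_le) (use u t in \<open>auto intro!: exI[of _ 0] bdist_upper[OF _ L0 L]\<close>)
    moreover have "0 < bdist y" using y bdist_pos_iff dom_closure by blast
    ultimately have "0 < bdist x * exp (L * t)" by linarith
    then have "0 < bdist x" by (simp add: zero_less_mult_iff)
    then have xd: "x \<in> \<Omega>" using bdist_pos_iff x by blast
    have "(\<lambda>n. X t (u (\<sigma> n))) \<longlonglongrightarrow> X t x"
      using continuous_on_tendsto_compose[OF X_continuous_dom[OF t] lim xd] u(1) by (simp add: o_def)
    moreover have "(\<lambda>n. X t (u (\<sigma> n))) \<longlonglongrightarrow> y"
      using LIMSEQ_subseq_LIMSEQ[OF w(2) \<sigma>] by (simp add: o_def u(2))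
    ultimately show "y \<in> X t ` \<Omega>" using LIMSEQ_unique xd by blast
  qed
  have "closedin (top_of_set \<Omega>) (X t ` \<Omega>)"
    unfolding closedin_closed using cl sub closure_subset[of "X t ` \<Omega>"]
    by (intro exI[of _ "closure (X t ` \<Omega>)"]) auto
  moreover have "openin (top_of_set \<Omega>) (X t ` \<Omega>)"
    using op sub by (simp add: openin_open_eq open_dom)
  ultimately show ?thesis
    using conn_dom nonempty_dom unfolding connected_clopen by blast
qed

section \<open>Differentiability of the flow in the initial point and its Jacobian\<close>

text \<open>The variational equation is a linear equation in the space of operators: its coefficient
  at time \<open>t\<close> is composition from the left with \<open>Dv t (X t x)\<close>, continuous
  in time by joint continuity of \<open>Dv\<close>.\<close>

lemma first_variation_exists:
  assumes x: "x \<in> \<Omega>" and T: "0 \<le> T"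
  obtains J :: "real \<Rightarrow> 'a \<Rightarrow>\<^sub>L 'a" where "J 0 = id_blinfun"
    "\<And>t. t \<in> {0..T} \<Longrightarrow> (J has_vector_derivative Dv t (X t x) o\<^sub>L J t) (at t within {0..T})"
proof -
  define F :: "real \<Rightarrow> ('a \<Rightarrow>\<^sub>L 'a) \<Rightarrow>\<^sub>L ('a \<Rightarrow>\<^sub>L 'a)" where
    "F = (\<lambda>t. bounded_bilinear.prod_right (o\<^sub>L) (Dv t (X t x)))"
  have F_apply: "F t B = Dv t (X t x) o\<^sub>L B" for t B
    by (simp add: F_def bounded_bilinear.prod_right.rep_eq[OF bounded_bilinear_blinfun_compose])
  have "continuous_on {0..T} (\<lambda>t. (t, X t x))"
    by (intro continuous_intros continuous_on_subset[OF X_continuous] dom_closure x) auto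
  from continuous_on_compose2[OF Dv_cont this] have "continuous_on {0..T} (\<lambda>t. Dv t (X t x))"
    using X_in_dom[OF x] by force
  then have "continuous_on {0..T} F" unfolding F_def
    by (intro bounded_linear.continuous_on[OF bounded_bilinear.bounded_linear_prod_right]
        bounded_bilinear_blinfun_compose)
  from linear_ode_exists[OF T this, of id_blinfun] show ?thesis
    using that by (auto simp: F_apply)
qed

text \<open>The tube is parametrised by time and displacement from the trajectory, that is, by a
  compact product, on which \<open>Dv\<close> is uniformly continuous. This makes the linearization
  error below uniform in time.\<close>

lemma Dv_uniform:
  assumes x: "x \<in> \<Omega>" and r: "0 < r" "\<And>t. t \<in> {0..T} \<Longrightarrow> cball (X t x) r \<subseteq> \<Omega>" and e: "0 < e"
  obtains \<delta> where "0 < \<delta>" "\<delta> \<le> r"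
    "\<And>t z. t \<in> {0..T} \<Longrightarrow> z \<in> ball (X t x) \<delta> \<Longrightarrow> norm (Dv t z - Dv t (X t x)) \<le> e"
proof -
  let ?K = "{0..T} \<times> cball (0::'a) r"
  have "continuous_on ?K (\<lambda>p. (fst p, X (fst p) x + snd p))"
    by (intro continuous_intros continuous_on_compose2[OF X_continuous[OF dom_closure[OF x]]]) auto
  moreover have "(\<lambda>p. (fst p, X (fst p) x + snd p)) ` ?K \<subseteq> {0..} \<times> \<Omega>"
    using r(2) by (force simp: dist_norm)
  ultimately have "continuous_on ?K (\<lambda>p. Dv (fst p) (X (fst p) x + snd p))"
    using continuous_on_compose2[OF Dv_cont, of ?K "\<lambda>p. (fst p, X (fst p) x + snd p)"] by simp
  then have "uniformly_continuous_on ?K (\<lambda>p. Dv (fst p) (X (fst p) x + snd p))"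
    by (rule compact_uniformly_continuous) (intro compact_Times compact_Icc compact_cball)
  then obtain d where d: "0 < d" "\<And>p q. p \<in> ?K \<Longrightarrow> q \<in> ?K \<Longrightarrow> dist q p < d \<Longrightarrow>
      dist (Dv (fst q) (X (fst q) x + snd q)) (Dv (fst p) (X (fst p) x + snd p)) < e"
    using e unfolding uniformly_continuous_on_def by metis
  show ?thesis
  proof
    show "0 < min d r" "min d r \<le> r" using d r by auto
    fix t z assume t: "t \<in> {0..T}" and z: "z \<in> ball (X t x) (min d r)"
    have "dist (Dv (fst (t, z - X t x)) (X (fst (t, z - X t x)) x + snd (t, z - X t x)))
        (Dv (fst (t, 0::'a)) (X (fst (t, 0::'a)) x + snd (t, 0::'a))) < e"
      using t z r(1) by (intro d(2)) (auto simp: dist_norm norm_minus_commute dist_Pair_Pair)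
    then show "norm (Dv t z - Dv t (X t x)) \<le> e" by (simp add: dist_norm)
  qed
qed

text \<open>The remainder \<open>R\<close> of the linearization starts at zero and satisfies the
  variational equation up to an error that is small relative to \<open>norm (y - x)\<close>;
  Gronwall keeps it that small.\<close>

lemma first_variation_derivative:
  assumes x: "x \<in> \<Omega>" and J0: "J 0 = id_blinfun"
    and J: "\<And>t. t \<in> {0..T} \<Longrightarrow> (J has_vector_derivative Dv t (X t x) o\<^sub>L J t) (at t within {0..T})"
    and t: "t \<in> {0..T}"
  shows "(X t has_derivative J t) (at x)"
proof -
  note xc = dom_closure[OF x]
  obtain L where L0: "0 \<le> L" and L: "\<And>s y. s \<in> {0..T} \<Longrightarrow> y \<in> \<Omega> \<Longrightarrow> norm (Dv s y) \<le> L"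
    using Dv_bound_nonneg[of T] by metis
  obtain r where r: "0 < r" "\<And>s. s \<in> {0..T} \<Longrightarrow> cball (X s x) r \<subseteq> \<Omega>"
    using trajectory_tube[OF x, of T] by metis
  \<comment> \<open>One exponential comes from the spreading of nearby trajectories;
    \<open>T\<close> and the other come from Gronwall with a constant source. Below,
    \<open>M + 1\<close> is the divisor because \<open>M\<close> is 0 for
    \<open>T = 0\<close>.\<close>
  define M where "M = exp (L * T) * T * exp (L * T)"
  have M0: "0 \<le> M" using t by (simp add: M_def)
  have "\<forall>\<^sub>F y in at x. norm (X t y - X t x - J t (y - x)) \<le> \<epsilon> * norm (y - x)" if \<epsilon>: "0 < \<epsilon>" for \<epsilon>
  proof -
    define e where "e = \<epsilon> / (M + 1)"
    have e: "0 < e" using \<epsilon> M0 by (simp add: e_def)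
    obtain \<delta> where \<delta>: "0 < \<delta>" "\<delta> \<le> r"
      "\<And>t z. t \<in> {0..T} \<Longrightarrow> z \<in> ball (X t x) \<delta> \<Longrightarrow> norm (Dv t z - Dv t (X t x)) \<le> e"
      using Dv_uniform[OF x r e] by metis
    have "((\<lambda>y. norm (y - x) * exp (L * T)) \<longlongrightarrow> norm (x - x) * exp (L * T)) (at x)"
      by (intro tendsto_intros)
    then have "((\<lambda>y. norm (y - x) * exp (L * T)) \<longlongrightarrow> 0) (at x)" by simp
    then have "\<forall>\<^sub>F y in at x. norm (y - x) * exp (L * T) < \<delta>" using \<delta>(1) by (rule order_tendstoD)
    moreover have "\<forall>\<^sub>F y in at x. y \<in> \<Omega>" using open_dom x by (rule eventually_at_in_open')
    ultimately show ?thesis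
    proof eventually_elim
      case (elim y)
      have near: "norm (X s y - X s x) \<le> norm (y - x) * exp (L * T)" if s: "s \<in> {0..T}" for s
      proof -
        have "norm (X s y - X s x) \<le> norm (y - x) * exp (L * s)"
          using elim \<delta> s by (intro X_lipschitz_local[OF x L0 L r]) auto
        also have "\<dots> \<le> norm (y - x) * exp (L * T)"
          using s L0 by (auto intro!: mult_left_mono)
        finally show ?thesis .
      qed
      define R where "R = (\<lambda>s. X s y - X s x - J s (y - x))"
      define R' where "R' = (\<lambda>s. v s (X s y) - v s (X s x) - Dv s (X s x) (J s (y - x)))"
      \<comment> \<open>The linearization error: the variation \<open>e\<close> of \<open>Dv\<close>
        over the ball times a bound for the distance between the two trajectories.\<close>
      define E where "E = e * (norm (y - x) * exp (L * T))"
      have E0: "0 \<le> E" using e by (simp add: E_def)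
      have "norm (R t) \<le> (norm (R 0) + E * (t - 0)) * exp (L * (t - 0))"
      proof (rule norm_gronwall[where y' = R' and a = 0 and b = T
            and \<delta> = "(norm (R 0) + E * (T - 0)) * exp (L * (T - 0)) + 1"])
        show "(R has_vector_derivative R' s) (at s within {0..T})" if s: "s \<in> {0..T}" for s
        proof -
          have "((\<lambda>s. J s (y - x)) has_vector_derivative (Dv s (X s x) o\<^sub>L J s) (y - x)) (at s within {0..T})"
            using bounded_linear.has_vector_derivative[OF _ J[OF s], of "\<lambda>B. B (y - x)"]
            by (simp add: blinfun.bounded_linear_left)
          then show ?thesis unfolding R_def R'_def
            using s elim by (intro has_vector_derivative_diff X_der_Icc dom_closure x) auto
        qed
        fix s assume s: "s \<in> {0..T}"
        let ?B = "ball (X s x) \<delta>"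
        have sub: "?B \<subseteq> \<Omega>" using r(2)[OF s] \<delta>(2) by (auto simp: subset_iff)
        have yB: "X s y \<in> ?B"
          using near[OF s] elim by (simp add: dist_norm norm_minus_commute)
        have "norm (v s (X s y) - v s (X s x) - Dv s (X s x) (X s y - X s x)) \<le> norm (X s y - X s x) * e"
        proof (rule differentiable_bound_linearization[where S = ?B and f' = "\<lambda>z. blinfun_apply (Dv s z)"])
          show "X s x + u *\<^sub>R (X s y - X s x) \<in> ?B" if u: "u \<in> {0..1}" for u
            using convexD_alt[OF convex_ball _ yB, of "X s x" u] u \<delta>(1)
            by (simp add: algebra_simps)
          show "(v s has_derivative Dv s z) (at z within ?B)" if "z \<in> ?B" for z
          proof (rule has_derivative_at_withinI[OF v_der])
            show "0 \<le> s" using s by simp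
            show "z \<in> \<Omega>" using that sub by (rule subsetD[rotated])
          qed
          show "onorm (blinfun_apply (Dv s z) - blinfun_apply (Dv s (X s x))) \<le> e" if "z \<in> ?B" for z
            using \<delta>(3)[OF s that] by (simp add: norm_blinfun.rep_eq minus_blinfun.rep_eq fun_diff_def)
        qed (use \<delta>(1) in simp)
        also have "\<dots> \<le> E" unfolding E_def using near[OF s] e by (simp add: mult.commute)
        finally have 1: "norm (v s (X s y) - v s (X s x) - Dv s (X s x) (X s y - X s x)) \<le> E" .
        have 2: "norm (Dv s (X s x) (R s)) \<le> L * norm (R s)"
          using norm_blinfun[of "Dv s (X s x)" "R s"] L[OF s, of "X s x"] X_in_dom[OF x, of s] s
          by (meson atLeastAtMost_iff mult_right_mono norm_ge_zero order_trans)
        have "R' s = (v s (X s y) - v s (X s x) - Dv s (X s x) (X s y - X s x)) + Dv s (X s x) (R s)"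
          by (simp add: R_def R'_def blinfun.diff_right)
        also have "norm \<dots> \<le> E + L * norm (R s)" using 1 2 by (rule norm_triangle_mono)
        finally show "norm (R' s) \<le> L * norm (R s) + E" by simp
      qed (use t L0 E0 in auto)
      also have "R 0 = 0" using J0 X_0 xc dom_closure elim by (simp add: R_def)
      also have "(norm (0::'a) + E * (t - 0)) * exp (L * (t - 0)) \<le> (E * T) * exp (L * T)"
        using t L0 E0 by (auto intro!: mult_mono)
      also have "\<dots> = e * M * norm (y - x)" by (simp add: E_def M_def)
      also have "\<dots> \<le> \<epsilon> * norm (y - x)"
        using M0 \<epsilon> by (intro mult_right_mono) (auto simp: e_def field_simps)
      finally show ?case by (simp add: R_def)
    qed
  qed
  then show ?thesis
    by (auto simp only: has_derivative_within_alt2 blinfun.bounded_linear_right)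
qed

text \<open>Liouville's formula with the integral of the divergence replaced by any antiderivative
  \<open>m\<close>: then \<open>edet (J s) * exp (- m s)\<close> has derivative zero, and
  \<open>wlf_jacobian\<close> can supply an explicit \<open>m\<close>.\<close>

lemma X_jacobian:
  assumes x: "x \<in> \<Omega>" and t: "0 \<le> t"
    and m: "\<And>s. 0 \<le> s \<Longrightarrow> (m has_real_derivative (\<Sum>b\<in>Basis. Dv s (X s x) b \<bullet> b)) (at s within {0..})"
  shows "\<exists>D. (X t has_derivative D) (at x) \<and> edet D = exp (m t - m 0)"
proof -
  obtain J :: "real \<Rightarrow> 'a \<Rightarrow>\<^sub>L 'a" where J0: "J 0 = id_blinfun" and
    J: "\<And>s. s \<in> {0..t} \<Longrightarrow> (J has_vector_derivative Dv s (X s x) o\<^sub>L J s) (at s within {0..t})"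
    using first_variation_exists[OF x t] by metis
  have der: "((\<lambda>s. edet (J s) * exp (- m s)) has_real_derivative 0) (at s within {0..t})"
    if s: "s \<in> {0..t}" for s
  proof -
    have "(m has_real_derivative (\<Sum>b\<in>Basis. Dv s (X s x) b \<bullet> b)) (at s within {0..t})"
      using s by (intro DERIV_subset[OF m]) auto
    then show ?thesis using has_real_derivative_edet[OF J[OF s]]
      by (auto intro!: derivative_eq_intros simp: algebra_simps)
  qed
  have "edet (J t) * exp (- m t) = edet (J 0) * exp (- m 0)"
    using has_field_derivative_zero_constant[of "{0..t}" "\<lambda>s. edet (J s) * exp (- m s)"] der t by force
  moreover have "edet (J 0) = 1" using edet_id by (simp add: J0 id_blinfun.rep_eq)
  ultimately have "edet (J t) = exp (m t - m 0)"
    by (simp add: exp_diff exp_minus field_simps)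
  then show ?thesis using first_variation_derivative[OF x J0 J, of t] t by auto
qed

end

section \<open>Gradients, Hessians and normals\<close>

lemma partial_deriv_interior: "x \<in> \<Omega> \<Longrightarrow> partial_deriv \<Omega> b f x = frechet_derivative f (at x) b"
  by (simp add: partial_deriv_def cont_ext_def)

lemma has_derivative_grad:
  assumes "f differentiable at x" "x \<in> \<Omega>"
  shows "(f has_derivative (\<lambda>h. grad \<Omega> f x \<bullet> h)) (at x)"
proof -
  have D: "(f has_derivative frechet_derivative f (at x)) (at x)"
    using assms(1) by (simp add: frechet_derivative_works)
  then have lin: "linear (frechet_derivative f (at x))" by (rule has_derivative_linear)
  have "frechet_derivative f (at x) h = grad \<Omega> f x \<bullet> h" for h
  proof -
    have "frechet_derivative f (at x) h = frechet_derivative f (at x) (\<Sum>b\<in>Basis. (h \<bullet> b) *\<^sub>R b)"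
      by (simp add: euclidean_representation)
    also have "\<dots> = (\<Sum>b\<in>Basis. (h \<bullet> b) * frechet_derivative f (at x) b)"
      by (simp add: linear_sum[OF lin] linear_cmul[OF lin])
    also have "\<dots> = grad \<Omega> f x \<bullet> h"
      using assms(2) by (simp add: grad_def inner_sum_left partial_deriv_interior inner_commute[of h] mult.commute)
    finally show ?thesis .
  qed
  then have "frechet_derivative f (at x) = (\<lambda>h. grad \<Omega> f x \<bullet> h)" by (rule ext)
  with D show ?thesis by simp
qed

text \<open>Written as a sum of fixed operators with the second partials as coefficients, so that
  continuity and bounds in time and space are inherited from these; \<open>b\<close> is the
  component of the gradient, \<open>c\<close> the direction.\<close>

definition hessian :: "'a::euclidean_space set \<Rightarrow> ('a \<Rightarrow> real) \<Rightarrow> 'a \<Rightarrow> 'a \<Rightarrow>\<^sub>L 'a" where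
  "hessian \<Omega> f x = (\<Sum>b\<in>Basis. \<Sum>c\<in>Basis.
     partial_deriv \<Omega> c (partial_deriv \<Omega> b f) x *\<^sub>R Blinfun (\<lambda>h. (h \<bullet> c) *\<^sub>R b))"

lemma hessian_apply:
  "hessian \<Omega> f x h = (\<Sum>b\<in>Basis. (grad \<Omega> (partial_deriv \<Omega> b f) x \<bullet> h) *\<^sub>R b)"
proof -
  have bl: "bounded_linear (\<lambda>h::'a. (h \<bullet> c) *\<^sub>R b)" for b c :: 'a
    by (intro bounded_linear_intros)
  show ?thesis
    by (simp add: hessian_def blinfun.sum_left blinfun.scaleR_left bounded_linear_Blinfun_apply[OF bl]
        grad_def inner_sum_left scaleR_sum_left inner_commute[of h])
qed

lemma has_derivative_grad_hessian:
  assumes f: "Ck 2 \<Omega> S f" and x: "x \<in> \<Omega>"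
  shows "(grad \<Omega> f has_derivative hessian \<Omega> f x) (at x)"
proof -
  have "partial_deriv \<Omega> b f differentiable at x" if "b \<in> Basis" for b
    using f x that by (simp add: numeral_2_eq_2)
  then have "((\<lambda>y. \<Sum>b\<in>Basis. partial_deriv \<Omega> b f y *\<^sub>R b) has_derivative
      (\<lambda>h. \<Sum>b\<in>Basis. (grad \<Omega> (partial_deriv \<Omega> b f) x \<bullet> h) *\<^sub>R b)) (at x)"
    by (intro has_derivative_sum has_derivative_scaleR_left has_derivative_grad x)
  then show ?thesis by (simp add: grad_def[abs_def] hessian_apply[abs_def])
qed

lemma continuous_on_grad:
  assumes "Ck (Suc k) \<Omega> S f" shows "continuous_on S (grad \<Omega> f)"
proof -
  have "continuous_on S (partial_deriv \<Omega> b f)" if "b \<in> Basis" for b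
    using assms that by (cases k) auto
  then show ?thesis unfolding grad_def[abs_def] by (intro continuous_intros)
qed

text \<open>After division by \<open>\<rho> x\<close>, the first term is the growth rate of the
  Jacobian and the second that of \<open>ln \<rho>\<close> along the gradient flow of
  \<open>f\<close>.\<close>

lemma divergence_scaled_grad:
  assumes \<rho>: "\<rho> differentiable at x" and f: "Ck 2 \<Omega> S f" and x: "x \<in> \<Omega>"
  shows "divergence (\<lambda>y. \<rho> y *\<^sub>R grad \<Omega> f y) x =
    \<rho> x * (\<Sum>b\<in>Basis. hessian \<Omega> f x b \<bullet> b) + grad \<Omega> \<rho> x \<bullet> grad \<Omega> f x"
proof -
  have "((\<lambda>y. \<rho> y *\<^sub>R grad \<Omega> f y) has_derivative
      (\<lambda>h. \<rho> x *\<^sub>R hessian \<Omega> f x h + (grad \<Omega> \<rho> x \<bullet> h) *\<^sub>R grad \<Omega> f x)) (at x)"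
    by (intro has_derivative_scaleR has_derivative_grad[OF \<rho> x] has_derivative_grad_hessian[OF f x])
  from frechet_derivative_at[OF this] have
    "frechet_derivative (\<lambda>y. \<rho> y *\<^sub>R grad \<Omega> f y) (at x) =
      (\<lambda>h. \<rho> x *\<^sub>R hessian \<Omega> f x h + (grad \<Omega> \<rho> x \<bullet> h) *\<^sub>R grad \<Omega> f x)" by simp
  moreover have "(\<Sum>b\<in>Basis. (grad \<Omega> \<rho> x \<bullet> b) * (grad \<Omega> f x \<bullet> b)) = grad \<Omega> \<rho> x \<bullet> grad \<Omega> f x"
    by (rule euclidean_inner[symmetric])
  ultimately show ?thesis
    by (simp add: divergence_def inner_add_left sum.distrib sum_distrib_left)
qed

lemma partial_deriv_cong:
  assumes "open \<Omega>" "x \<in> \<Omega>" "\<And>y. y \<in> \<Omega> \<Longrightarrow> f y = g y"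
  shows "partial_deriv \<Omega> b f x = partial_deriv \<Omega> b g x"
proof -
  have "(f has_derivative D) (at x) \<longleftrightarrow> (g has_derivative D) (at x)" for D
    using assms by (metis has_derivative_transform_within_open)
  then show ?thesis
    using assms(2) by (simp add: partial_deriv_interior frechet_derivative_def)
qed

lemma partial_deriv_diff:
  assumes "f differentiable at x" "g differentiable at x" "x \<in> \<Omega>"
  shows "partial_deriv \<Omega> b (\<lambda>y. f y - g y) x = partial_deriv \<Omega> b f x - partial_deriv \<Omega> b g x"
proof -
  have "((\<lambda>y. f y - g y) has_derivative (\<lambda>h. frechet_derivative f (at x) h - frechet_derivative g (at x) h)) (at x)"
    using assms by (intro has_derivative_diff) (simp_all add: frechet_derivative_works)
  from frechet_derivative_at[OF this] show ?thesis
    using assms(3) by (simp add: partial_deriv_interior) metis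
qed

text \<open>Inside \<Omega> partial derivatives commute with the difference, and the recursive norm
  contains the sup norm of every second partial as one of its summands.\<close>

lemma second_partial_diff_le_holder_norm:
  assumes "open \<Omega>" and f: "Ck 2 \<Omega> S f" and g: "Ck 2 \<Omega> S g"
    and x: "x \<in> \<Omega>" and b: "b \<in> Basis" and c: "c \<in> Basis"
  shows "ennreal \<bar>partial_deriv \<Omega> c (partial_deriv \<Omega> b f) x - partial_deriv \<Omega> c (partial_deriv \<Omega> b g) x\<bar>
    \<le> holder_norm 2 \<alpha> \<Omega> (\<lambda>y. f y - g y)"
proof -
  let ?u = "\<lambda>y. f y - g y"
  have d: "f differentiable at y" "g differentiable at y"
    "partial_deriv \<Omega> b f differentiable at y" "partial_deriv \<Omega> b g differentiable at y" if "y \<in> \<Omega>" for y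
    using f g that b by (auto simp: numeral_2_eq_2)
  have "partial_deriv \<Omega> c (partial_deriv \<Omega> b ?u) x =
      partial_deriv \<Omega> c (\<lambda>y. partial_deriv \<Omega> b f y - partial_deriv \<Omega> b g y) x"
    by (rule partial_deriv_cong[OF \<open>open \<Omega>\<close> x]) (intro partial_deriv_diff d)
  also have "\<dots> = partial_deriv \<Omega> c (partial_deriv \<Omega> b f) x - partial_deriv \<Omega> c (partial_deriv \<Omega> b g) x"
    by (intro partial_deriv_diff d x)
  finally have eq: "partial_deriv \<Omega> c (partial_deriv \<Omega> b ?u) x = \<dots>" .
  have "ennreal \<bar>partial_deriv \<Omega> c (partial_deriv \<Omega> b ?u) x\<bar> \<le> sup_norm (closure \<Omega>) (partial_deriv \<Omega> c (partial_deriv \<Omega> b ?u))"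
    unfolding sup_norm_def using x closure_subset by (intro SUP_upper) blast
  also have "\<dots> \<le> holder_norm 0 \<alpha> \<Omega> (partial_deriv \<Omega> c (partial_deriv \<Omega> b ?u))"
    by simp
  also have "\<dots> \<le> (\<Sum>c\<in>Basis. holder_norm 0 \<alpha> \<Omega> (partial_deriv \<Omega> c (partial_deriv \<Omega> b ?u)))"
    using c by (intro member_le_sum) auto
  also have "\<dots> \<le> holder_norm 1 \<alpha> \<Omega> (partial_deriv \<Omega> b ?u)" by (simp add: add_increasing)
  also have "\<dots> \<le> (\<Sum>b\<in>Basis. holder_norm 1 \<alpha> \<Omega> (partial_deriv \<Omega> b ?u))"
    using b by (intro member_le_sum) auto
  also have "\<dots> \<le> holder_norm 2 \<alpha> \<Omega> ?u" by (simp add: numeral_2_eq_2 add_increasing)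
  finally show ?thesis unfolding eq .
qed

section \<open>Normals at nearest boundary points\<close>

text \<open>Let \<open>p\<close> be the part of \<open>G\<close> orthogonal to \<open>a\<close>.
  Testing with \<open>p + k *\<^sub>R a\<close> and letting \<open>k\<close> decrease to 0 gives
  \<open>p \<bullet> p \<le> 0\<close>.\<close>

lemma inner_normal_collinear:
  fixes G a :: "'a::real_inner"
  assumes a: "a \<noteq> 0" and neg: "\<And>w. 0 < w \<bullet> a \<Longrightarrow> G \<bullet> w \<le> 0"
  shows "G = ((G \<bullet> a) / (a \<bullet> a)) *\<^sub>R a"
proof -
  define \<mu> where "\<mu> = (G \<bullet> a) / (a \<bullet> a)"
  define p where "p = G - \<mu> *\<^sub>R a"
  have aa: "0 < a \<bullet> a" using a by simp
  have pa: "p \<bullet> a = 0" using a by (simp add: p_def \<mu>_def inner_diff_left)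
  have Gp: "G \<bullet> p = p \<bullet> p"
    using pa by (simp add: p_def inner_diff_left inner_diff_right inner_commute)
  have "p \<bullet> p + k * (G \<bullet> a) \<le> 0" if "0 < k" for k
    using neg[of "p + k *\<^sub>R a"] that aa pa by (simp add: inner_add_left inner_add_right Gp)
  then have "\<forall>\<^sub>F k in at_right 0. p \<bullet> p + k * (G \<bullet> a) \<le> 0"
    by (auto intro: eventually_mono[OF eventually_at_right_less])
  moreover have "((\<lambda>k. p \<bullet> p + k * (G \<bullet> a)) \<longlongrightarrow> p \<bullet> p + 0 * (G \<bullet> a)) (at_right 0)"
    by (intro tendsto_intros)
  ultimately have "p \<bullet> p + 0 * (G \<bullet> a) \<le> 0"
    by (intro tendsto_upperbound) auto
  then have "p = 0" using inner_gt_zero_iff[of p] by linarith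
  then show ?thesis by (simp add: p_def \<mu>_def)
qed

text \<open>The ball about \<open>y\<close> through \<open>z\<close> touches the boundary from
  inside, so the defining function is negative on entering it from \<open>z\<close>. Its gradient
  thus has nonpositive product with every direction into the ball, which forces it to be parallel to
  \<open>y - z\<close>.\<close>

lemma outward_unit_normal_nearest:
  fixes \<Omega> :: "'a::euclidean_space set"
  assumes smooth: "smooth_boundary \<Omega>" and y: "y \<in> \<Omega>" and z: "z \<in> frontier \<Omega>"
    and near: "dist y z = infdist y (frontier \<Omega>)" and yz: "y \<noteq> z"
  shows "\<exists>n k. outward_unit_normal \<Omega> z n \<and> y - z = k *\<^sub>R n"
proof -
  obtain U g where ldf: "local_defining_function \<Omega> z U g"
    using smooth z unfolding smooth_boundary_def by blast
  then have U: "open U" "z \<in> U" and g: "Cinf U U g" and nz: "grad U g z \<noteq> 0"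
    and inside: "\<Omega> \<inter> U = {y\<in>U. g y < 0}" and bdry: "frontier \<Omega> \<inter> U = {y\<in>U. g y = 0}"
    unfolding local_defining_function_def by auto
  let ?G = "grad U g z" and ?a = "y - z"
  have "Ck 1 U U g" using g by (simp add: Cinf_def)
  then have "g differentiable at z" using U by simp
  from has_derivative_grad[OF this U(2)] have der: "(g has_derivative (\<lambda>h. ?G \<bullet> h)) (at z)" .
  have gz: "g z = 0" using z U bdry by blast
  have neg: "?G \<bullet> w \<le> 0" if w: "0 < w \<bullet> ?a" for w
  proof -
    have "((\<lambda>\<epsilon>. z + \<epsilon> *\<^sub>R w) has_derivative (\<lambda>\<epsilon>. \<epsilon> *\<^sub>R w)) (at 0)"
      by (auto intro!: derivative_eq_intros)
    then have "((\<lambda>\<epsilon>. g (z + \<epsilon> *\<^sub>R w)) has_derivative (\<lambda>\<epsilon>. ?G \<bullet> (\<epsilon> *\<^sub>R w))) (at 0)"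
      using der by (intro has_derivative_compose[of "\<lambda>\<epsilon>. z + \<epsilon> *\<^sub>R w" _ _ _ g]) auto
    then have "((\<lambda>\<epsilon>. g (z + \<epsilon> *\<^sub>R w)) has_real_derivative ?G \<bullet> w) (at 0)"
      by (simp add: has_field_derivative_def mult.commute[of "?G \<bullet> w"] mult_commute_abs)
    then have "((\<lambda>\<epsilon>. g (z + \<epsilon> *\<^sub>R w)) has_real_derivative ?G \<bullet> w) (at_right 0)"
      by (rule DERIV_subset) simp
    then have "((\<lambda>\<epsilon>. g (z + \<epsilon> *\<^sub>R w) / \<epsilon>) \<longlongrightarrow> ?G \<bullet> w) (at_right 0)"
      by (simp add: has_field_derivative_iff gz)
    moreover have "\<forall>\<^sub>F \<epsilon> in at_right 0. g (z + \<epsilon> *\<^sub>R w) / \<epsilon> \<le> 0"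
    proof -
      have "((\<lambda>\<epsilon>. z + \<epsilon> *\<^sub>R w) \<longlongrightarrow> z + 0 *\<^sub>R w) (at_right 0)" by (intro tendsto_intros)
      then have "\<forall>\<^sub>F \<epsilon> in at_right 0. z + \<epsilon> *\<^sub>R w \<in> U"
        using U by (intro topological_tendstoD) auto
      \<comment> \<open>For positive \<epsilon> this inequality says precisely that
        \<open>z + \<epsilon> *\<^sub>R w\<close> is strictly closer to \<open>y\<close> than
        \<open>z\<close> is.\<close>
      moreover have "((\<lambda>\<epsilon>. \<epsilon> * (w \<bullet> w)) \<longlongrightarrow> 0 * (w \<bullet> w)) (at_right 0)" by (intro tendsto_intros)
      then have "\<forall>\<^sub>F \<epsilon> in at_right 0. \<epsilon> * (w \<bullet> w) < 2 * (w \<bullet> ?a)"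
        using w by (intro order_tendstoD) auto
      ultimately show ?thesis using eventually_at_right_less
      proof eventually_elim
        case (elim \<epsilon>)
        have "(norm (?a - \<epsilon> *\<^sub>R w))\<^sup>2 = (norm ?a)\<^sup>2 - \<epsilon> * (2 * (w \<bullet> ?a) - \<epsilon> * (w \<bullet> w))"
          by (simp only: power2_norm_eq_inner inner_diff_left inner_diff_right inner_scaleR_left inner_scaleR_right)
            (simp add: algebra_simps inner_commute)
        also have "\<dots> < (norm ?a)\<^sup>2" using elim by simp
        finally have "norm (?a - \<epsilon> *\<^sub>R w) < norm ?a" by (rule power2_less_imp_less) simp
        then have "z + \<epsilon> *\<^sub>R w \<in> ball y (infdist y (frontier \<Omega>))"
          using near by (simp add: dist_norm algebra_simps)
        then have "z + \<epsilon> *\<^sub>R w \<in> \<Omega>" using ball_infdist_frontier_subset[OF y] by blast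
        then have "g (z + \<epsilon> *\<^sub>R w) < 0" using inside elim by blast
        then show ?case using elim by (simp add: divide_nonpos_pos)
      qed
    qed
    ultimately show ?thesis by (rule tendsto_upperbound) simp
  qed
  define \<mu> where "\<mu> = (?G \<bullet> ?a) / (?a \<bullet> ?a)"
  have G: "?G = \<mu> *\<^sub>R ?a" unfolding \<mu>_def using yz neg by (intro inner_normal_collinear) auto
  then have "\<mu> \<noteq> 0" using nz by auto
  then have "y - z = (norm ?G / \<mu>) *\<^sub>R (?G /\<^sub>R norm ?G)" using nz by (subst (3) G) simp
  then show ?thesis using ldf unfolding outward_unit_normal_def by blast
qed

section \<open>The flow of a WLF solution\<close>

text \<open>Compactness of the interval by bisection: boundedness is local and survives joining
  adjacent intervals. The filter leaves out its centre, whence the separate premise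
  \<open>at\<close>.\<close>

lemma local_bounds_imp_bounded_on_Icc:
  fixes h :: "real \<Rightarrow> 'b \<Rightarrow> real"
  assumes loc: "\<And>t. 0 \<le> t \<Longrightarrow> \<exists>B. \<forall>\<^sub>F s in at t within {0..}. \<forall>z\<in>A. \<bar>h s z\<bar> \<le> B"
    and at: "\<And>t. 0 \<le> t \<Longrightarrow> \<exists>B. \<forall>z\<in>A. \<bar>h t z\<bar> \<le> B"
  shows "\<exists>B. \<forall>t\<in>{0..T}. \<forall>z\<in>A. \<bar>h t z\<bar> \<le> B"
proof (cases "0 \<le> T")
  case True
  define P where "P = (\<lambda>a b. \<exists>B. \<forall>t\<in>{a..b} \<inter> {0..}. \<forall>z\<in>A. \<bar>h t z\<bar> \<le> B)"
  from True have "P 0 T"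
  proof (induction rule: Bolzano)
    case (trans a b c)
    then obtain B C where "\<forall>t\<in>{a..b} \<inter> {0..}. \<forall>z\<in>A. \<bar>h t z\<bar> \<le> B"
      "\<forall>t\<in>{b..c} \<inter> {0..}. \<forall>z\<in>A. \<bar>h t z\<bar> \<le> C" unfolding P_def by blast
    then show ?case unfolding P_def
      by (intro exI[of _ "max B C"]) (force simp: le_max_iff_disj)
  next
    case (local x)
    then have x: "0 \<le> x" by simp
    obtain B C where B: "\<forall>\<^sub>F s in at x within {0..}. \<forall>z\<in>A. \<bar>h s z\<bar> \<le> B" and C: "\<forall>z\<in>A. \<bar>h x z\<bar> \<le> C"
      using loc[OF x] at[OF x] by blast
    obtain d where d: "0 < d" "\<And>s. 0 \<le> s \<Longrightarrow> s \<noteq> x \<Longrightarrow> dist s x < d \<Longrightarrow> \<forall>z\<in>A. \<bar>h s z\<bar> \<le> B"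
      using B unfolding eventually_at by auto
    have "P a b" if ab: "a \<le> x" "x \<le> b" "b - a < d" for a b
      unfolding P_def
    proof (intro exI[of _ "max B C"] ballI)
      fix t z assume t: "t \<in> {a..b} \<inter> {0..}" and z: "z \<in> A"
      show "\<bar>h t z\<bar> \<le> max B C"
        using C d(2)[of t] t z ab by (cases "t = x") (auto simp: dist_real_def le_max_iff_disj)
    qed
    then show ?case using d(1) by blast
  qed
  then show ?thesis unfolding P_def by force
qed auto

text \<open>Continuity in time with values in the Hoelder space, reduced to what the flow needs:
  closeness of second partials uniformly in space.\<close>

lemma second_partials_uniformly_close:
  assumes "open \<Omega>" and reg: "\<And>T. 0 < T \<Longrightarrow> Cont_holder T 2 \<alpha> \<Omega> \<phi>"
    and b: "b \<in> Basis" and c: "c \<in> Basis" and t: "0 \<le> t" and e: "0 < e"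
  shows "\<forall>\<^sub>F s in at t within {0..}. \<forall>z\<in>\<Omega>.
    \<bar>partial_deriv \<Omega> c (partial_deriv \<Omega> b (\<phi> s)) z - partial_deriv \<Omega> c (partial_deriv \<Omega> b (\<phi> t)) z\<bar> < e"
proof -
  have Ck: "Ck 2 \<Omega> (closure \<Omega>) (\<phi> s)" if "0 \<le> s" for s
    using reg[of "s + 1"] that by (auto simp: Cont_holder_def holder_space_def)
  have "((\<lambda>s. holder_norm 2 \<alpha> \<Omega> (\<lambda>x. \<phi> s x - \<phi> t x)) \<longlongrightarrow> 0) (at t within {0..t + 1})"
    using reg[of "t + 1"] t by (auto simp: Cont_holder_def)
  \<comment> \<open>The interval ends at \<open>t + 1\<close> because within \<open>{0..t}\<close>
    only times before \<open>t\<close> would be seen.\<close>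
  moreover have "at t within {0..t + 1} = at t within {0..}"
    by (rule at_within_nhd[of _ "{..<t + 1}"]) auto
  ultimately have "((\<lambda>s. holder_norm 2 \<alpha> \<Omega> (\<lambda>x. \<phi> s x - \<phi> t x)) \<longlongrightarrow> 0) (at t within {0..})" by simp
  then have "\<forall>\<^sub>F s in at t within {0..}. holder_norm 2 \<alpha> \<Omega> (\<lambda>x. \<phi> s x - \<phi> t x) < ennreal e"
    using e by (intro order_tendstoD(2)) auto
  moreover have "\<forall>\<^sub>F s in at t within {0..}. 0 \<le> s" by (simp add: eventually_at_filter)
  ultimately show ?thesis
  proof eventually_elim
    case (elim s)
    show ?case
    proof
      fix z assume z: "z \<in> \<Omega>"
      from second_partial_diff_le_holder_norm[OF \<open>open \<Omega>\<close> Ck Ck z b c, of s t \<alpha>] elim t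
      have "ennreal \<bar>partial_deriv \<Omega> c (partial_deriv \<Omega> b (\<phi> s)) z - partial_deriv \<Omega> c (partial_deriv \<Omega> b (\<phi> t)) z\<bar> < ennreal e"
        by (meson order_le_less_trans)
      then show "\<bar>partial_deriv \<Omega> c (partial_deriv \<Omega> b (\<phi> s)) z - partial_deriv \<Omega> c (partial_deriv \<Omega> b (\<phi> t)) z\<bar> < e"
        by (simp add: ennreal_less_iff)
    qed
  qed
qed

text \<open>Second partials are continuous in time uniformly in space, and continuous in space up to
  the boundary at each time; a triangle inequality through \<open>H b c t z\<close> gives joint
  continuity. Tangency is the no-flux condition at nearest boundary points.\<close>

lemma wlf_tangential_flow:
  assumes dom: "smooth_bounded_domain \<Omega>"
    and sol: "wlf_solution \<Omega> \<rho> \<omega>\<^sub>0 \<omega> \<phi> \<omega>\<^sub>m X"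
    and reg: "\<And>T. 0 < T \<Longrightarrow> Cont_holder T 2 \<alpha> \<Omega> \<phi>"
  shows "tangential_flow \<Omega> (\<lambda>t. grad \<Omega> (\<phi> t)) (\<lambda>t. hessian \<Omega> (\<phi> t)) X"
proof (rule tangential_flow.intro)
  show "open \<Omega>" "connected \<Omega>" "bounded \<Omega>" "\<Omega> \<noteq> {}"
    using dom by (auto simp: smooth_bounded_domain_def)
  note op = \<open>open \<Omega>\<close>
  have Ck: "Ck 2 \<Omega> (closure \<Omega>) (\<phi> s)" if "0 \<le> s" for s
    using reg[of "s + 1"] that by (auto simp: Cont_holder_def holder_space_def)
  show "continuous_on (closure \<Omega>) (grad \<Omega> (\<phi> t))" if "0 \<le> t" for t
    using Ck[OF that] by (intro continuous_on_grad[of 1]) (simp add: numeral_2_eq_2)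
  show "(grad \<Omega> (\<phi> t) has_derivative hessian \<Omega> (\<phi> t) y) (at y)" if "0 \<le> t" "y \<in> \<Omega>" for t y
    using has_derivative_grad_hessian[OF Ck] that by blast
  define H where "H = (\<lambda>b c t y. partial_deriv \<Omega> c (partial_deriv \<Omega> b (\<phi> t)) y)"
  have H_cont: "continuous_on (closure \<Omega>) (H b c t)" if "0 \<le> t" "b \<in> Basis" "c \<in> Basis" for b c t
    using Ck[of t] that by (simp add: numeral_2_eq_2 H_def)
  have H_near: "\<forall>\<^sub>F s in at t within {0..}. \<forall>z\<in>\<Omega>. \<bar>H b c s z - H b c t z\<bar> < e"
    if "0 \<le> t" "b \<in> Basis" "c \<in> Basis" "0 < e" for b c t e
    unfolding H_def using that by (intro second_partials_uniformly_close[OF op reg])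
  have H_bdd: "\<exists>B. \<forall>z\<in>\<Omega>. \<bar>H b c t z\<bar> \<le> B" if "0 \<le> t" "b \<in> Basis" "c \<in> Basis" for b c t
  proof -
    have "bounded (H b c t ` closure \<Omega>)"
      using dom that by (intro compact_imp_bounded compact_continuous_image H_cont)
        (auto simp: smooth_bounded_domain_def compact_closure)
    then show ?thesis using closure_subset[of \<Omega>] by (force simp: bounded_iff)
  qed
  have H_bdd_Icc: "\<exists>B. \<forall>t\<in>{0..T}. \<forall>z\<in>\<Omega>. \<bar>H b c t z\<bar> \<le> B" if "b \<in> Basis" "c \<in> Basis" for b c T
  proof (rule local_bounds_imp_bounded_on_Icc)
    fix t :: real assume t: "0 \<le> t"
    then obtain B where B: "\<forall>z\<in>\<Omega>. \<bar>H b c t z\<bar> \<le> B" using H_bdd \<open>b \<in> Basis\<close> \<open>c \<in> Basis\<close> by blast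
    have "\<forall>\<^sub>F s in at t within {0..}. \<forall>z\<in>\<Omega>. \<bar>H b c s z - H b c t z\<bar> < 1"
      using t that by (intro H_near) auto
    then have "\<forall>\<^sub>F s in at t within {0..}. \<forall>z\<in>\<Omega>. \<bar>H b c s z\<bar> \<le> B + 1"
      by eventually_elim (use B in force)
    then show "\<exists>B. \<forall>\<^sub>F s in at t within {0..}. \<forall>z\<in>\<Omega>. \<bar>H b c s z\<bar> \<le> B" by blast
  qed (use H_bdd that in blast)
  have hess: "hessian \<Omega> (\<phi> t) y = (\<Sum>b\<in>Basis. \<Sum>c\<in>Basis. H b c t y *\<^sub>R Blinfun (\<lambda>h. (h \<bullet> c) *\<^sub>R b))" for t y
    by (simp add: hessian_def H_def)
  have H_joint: "continuous_on ({0..} \<times> \<Omega>) (\<lambda>p. H b c (fst p) (snd p))" if bc: "b \<in> Basis" "c \<in> Basis" for b c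
    unfolding continuous_on_def
  proof
    fix q :: "real \<times> 'a" assume "q \<in> {0..} \<times> \<Omega>"
    then obtain t y where q: "q = (t, y)" and t: "t \<in> {0..}" and y: "y \<in> \<Omega>" by blast
    show "((\<lambda>p. H b c (fst p) (snd p)) \<longlongrightarrow> H b c (fst q) (snd q)) (at q within {0..} \<times> \<Omega>)"
      unfolding q
    proof (rule tendstoI)
      fix e :: real assume e: "0 < e"
      obtain d1 where d1: "0 < d1" "\<And>s z. 0 \<le> s \<Longrightarrow> s \<noteq> t \<Longrightarrow> dist s t < d1 \<Longrightarrow> z \<in> \<Omega> \<Longrightarrow> \<bar>H b c s z - H b c t z\<bar> < e / 2"
        using H_near[of t b c "e / 2"] t bc e unfolding eventually_at by auto
      have near: "\<bar>H b c s z - H b c t z\<bar> < e / 2" if "0 \<le> s" "dist s t < d1" "z \<in> \<Omega>" for s z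
        using d1(2)[of s z] that e by (cases "s = t") auto
      obtain d2 where d2: "0 < d2" "\<And>z. z \<in> closure \<Omega> \<Longrightarrow> dist z y < d2 \<Longrightarrow> dist (H b c t z) (H b c t y) < e / 2"
        using H_cont[of t b c] t bc e y closure_subset[of \<Omega>] unfolding continuous_on_iff
        by (metis atLeast_iff half_gt_zero subsetD)
      show "\<forall>\<^sub>F p in at (t, y) within {0..} \<times> \<Omega>. dist (H b c (fst p) (snd p)) (H b c (fst (t, y)) (snd (t, y))) < e"
        unfolding eventually_at
      proof (intro exI[of _ "min d1 d2"] conjI ballI impI)
        show "0 < min d1 d2" using d1 d2 by simp
        fix p assume p: "p \<in> {0..} \<times> \<Omega>" and pd: "p \<noteq> (t, y) \<and> dist p (t, y) < min d1 d2"
        have "dist (fst p) t < d1" "dist (snd p) y < d2"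
          using pd dist_fst_le[of p "(t, y)"] dist_snd_le[of p "(t, y)"] by auto
        then have "\<bar>H b c (fst p) (snd p) - H b c t (snd p)\<bar> < e / 2" "dist (H b c t (snd p)) (H b c t y) < e / 2"
          using p near d2(2) closure_subset[of \<Omega>] by auto
        then show "dist (H b c (fst p) (snd p)) (H b c (fst (t, y)) (snd (t, y))) < e"
          unfolding dist_real_def fst_conv snd_conv by linarith
      qed
    qed
  qed
  show "continuous_on ({0..} \<times> \<Omega>) (\<lambda>(t, y). hessian \<Omega> (\<phi> t) y)"
    unfolding hess case_prod_unfold by (intro continuous_intros H_joint)
  show "\<exists>L. \<forall>t\<in>{0..T}. \<forall>y\<in>\<Omega>. norm (hessian \<Omega> (\<phi> t) y) \<le> L" for T
  proof -
    have "\<forall>b\<in>Basis. \<forall>c\<in>Basis. \<exists>B. \<forall>t\<in>{0..T}. \<forall>z\<in>\<Omega>. \<bar>H b c t z\<bar> \<le> B" using H_bdd_Icc by blast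
    then obtain B where B: "\<And>b c t z. b \<in> Basis \<Longrightarrow> c \<in> Basis \<Longrightarrow> t \<in> {0..T} \<Longrightarrow> z \<in> \<Omega> \<Longrightarrow> \<bar>H b c t z\<bar> \<le> B b c"
      by metis
    have "norm (hessian \<Omega> (\<phi> t) y) \<le> (\<Sum>b\<in>Basis. \<Sum>c\<in>Basis. B b c * norm (Blinfun (\<lambda>h::'a. (h \<bullet> c) *\<^sub>R b)))"
      if "t \<in> {0..T}" "y \<in> \<Omega>" for t y
      unfolding hess by (intro sum_norm_le) (auto intro!: mult_right_mono B that)
    then show ?thesis by blast
  qed
  show "grad \<Omega> (\<phi> t) z \<bullet> (y - z) = 0"
    if "0 \<le> t" "y \<in> \<Omega>" "z \<in> frontier \<Omega>" "dist y z = infdist y (frontier \<Omega>)" for t y z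
  proof -
    have "y \<noteq> z" using that op by (auto simp: frontier_def interior_open)
    moreover have "smooth_boundary \<Omega>" using dom by (simp add: smooth_bounded_domain_def)
    ultimately have "\<exists>n k. outward_unit_normal \<Omega> z n \<and> y - z = k *\<^sub>R n"
      using that by (intro outward_unit_normal_nearest)
    then obtain n k where "outward_unit_normal \<Omega> z n" "y - z = k *\<^sub>R n" by blast
    then show ?thesis using sol that by (simp add: wlf_solution_def)
  qed
qed (use sol in \<open>auto simp: wlf_solution_def\<close>)

section \<open>Transported densities\<close>

lemma nn_integral_lebesgue_on:
  assumes "S \<in> sets borel"
  shows "(\<integral>\<^sup>+x. ennreal (f x) \<partial>lebesgue_on S) = (\<integral>\<^sup>+x. ennreal (indicator S x * f x) \<partial>lborel)"
proof -
  have "(\<integral>\<^sup>+x. ennreal (f x) \<partial>lebesgue_on S) = (\<integral>\<^sup>+x. ennreal (f x) * indicator S x \<partial>lebesgue)"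
    using assms by (intro nn_integral_restrict_space) auto
  also have "\<dots> = (\<integral>\<^sup>+x. ennreal (f x) * indicator S x \<partial>lborel)" by (rule nn_integral_completion)
  also have "\<dots> = (\<integral>\<^sup>+x. ennreal (indicator S x * f x) \<partial>lborel)"
    by (intro nn_integral_cong) (simp add: indicator_def)
  finally show ?thesis .
qed

text \<open>Change of variables for the integrand restricted to \<open>B\<close>; as
  \<open>X t\<close> maps \<Omega> onto itself, the image side is again an integral over all of
  \<Omega>.\<close>

lemma (in tangential_flow) pushforward_of_jacobian:
  assumes t: "0 \<le> t" and r: "continuous_on \<Omega> r" "\<And>y. y \<in> \<Omega> \<Longrightarrow> 0 \<le> r y"
    and u: "continuous_on \<Omega> u" "(\<integral>\<^sup>+x. ennreal (u x) \<partial>lebesgue_on \<Omega>) < \<infinity>"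
    and jac: "\<And>x. x \<in> \<Omega> \<Longrightarrow> \<exists>D. (X t has_derivative D) (at x) \<and> \<bar>edet D\<bar> * r (X t x) = u x"
    and B: "B \<in> sets borel"
  shows "(\<integral>\<^sup>+y. ennreal (indicator B y * r y) \<partial>lebesgue_on \<Omega>) =
    (\<integral>\<^sup>+x. ennreal (indicator B (X t x) * u x) \<partial>lebesgue_on \<Omega>)"
proof -
  obtain D where D: "\<And>x. x \<in> \<Omega> \<Longrightarrow> (X t has_derivative D x) (at x)"
    "\<And>x. x \<in> \<Omega> \<Longrightarrow> \<bar>edet (D x)\<bar> * r (X t x) = u x"
    using jac by metis
  have \<Omega>: "\<Omega> \<in> sets borel" using open_dom by simp
  have [measurable]: "X t \<in> borel_measurable (restrict_space borel \<Omega>)"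
    "r \<in> borel_measurable (restrict_space borel \<Omega>)" "u \<in> borel_measurable (restrict_space borel \<Omega>)"
    using X_continuous_dom[OF t] r u by (auto intro: borel_measurable_continuous_on_restrict)
  note [measurable] = B
  have [measurable]: "(\<lambda>x. x) \<in> borel_measurable (restrict_space borel \<Omega>)"
    by (intro borel_measurable_continuous_on_restrict continuous_intros)
  have m1: "(\<lambda>y. indicator B y * r y) \<in> borel_measurable (restrict_space borel \<Omega>)" by measurable
  have m2: "(\<lambda>x. indicator B (X t x) * u x) \<in> borel_measurable (restrict_space borel \<Omega>)" by measurable
  \<comment> \<open>The choice \<open>D\<close> is arbitrary outside \<Omega>. Replacing the
    Jacobian product by \<open>u\<close> also settles measurability, which is not known for
    \<open>D\<close> itself.\<close>
  have ind: "indicator \<Omega> x * (\<bar>edet (D x)\<bar> * (indicator B (X t x) * r (X t x))) =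
      indicator \<Omega> x * (indicator B (X t x) * u x)" for x
    using D(2)[of x] by (auto simp: indicator_def)
  have le: "(\<integral>\<^sup>+x. ennreal (indicator B (X t x) * u x) \<partial>lebesgue_on \<Omega>) \<le> (\<integral>\<^sup>+x. ennreal (u x) \<partial>lebesgue_on \<Omega>)"
    by (rule nn_integral_mono) (auto simp: indicator_def ennreal_leI)
  have "(\<integral>\<^sup>+y. ennreal (indicator (X t ` \<Omega>) y * (indicator B y * r y)) \<partial>lborel) =
      (\<integral>\<^sup>+x. ennreal (indicator \<Omega> x * (\<bar>edet (D x)\<bar> * (indicator B (X t x) * r (X t x)))) \<partial>lborel)"
  proof (rule nn_integral_change_of_variables[OF \<Omega> _ X_inj[OF t]])
    show "(X t has_derivative D x) (at x within \<Omega>)" if "x \<in> \<Omega>" for x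
      using D(1)[OF that] by (rule has_derivative_at_withinI)
    show "0 \<le> indicator B y * r y" if "y \<in> X t ` \<Omega>" for y
      using that r(2) X_image[OF t] by simp
    show "(\<lambda>y. indicator (X t ` \<Omega>) y * (indicator B y * r y)) \<in> borel_measurable borel"
      using m1 \<Omega> by (simp add: X_image[OF t] borel_measurable_restrict_space_iff)
    show "(\<lambda>x. indicator \<Omega> x * (\<bar>edet (D x)\<bar> * (indicator B (X t x) * r (X t x)))) \<in> borel_measurable borel"
      using m2 \<Omega> by (simp add: ind borel_measurable_restrict_space_iff)
    show "(\<integral>\<^sup>+x. ennreal (indicator \<Omega> x * (\<bar>edet (D x)\<bar> * (indicator B (X t x) * r (X t x)))) \<partial>lborel) < \<infinity>"
      using le u(2) unfolding ind nn_integral_lebesgue_on[OF \<Omega>, symmetric] by (rule le_less_trans)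
  qed
  then show ?thesis
    unfolding ind X_image[OF t] nn_integral_lebesgue_on[OF \<Omega>] .
qed

text \<open>The push-forward identity tests Borel sets only, whereas uniqueness of densities over
  Lebesgue measure asks for Lebesgue sets; these differ from Borel sets by null sets.\<close>

lemma AE_eq_of_borel_integrals:
  fixes f g :: "'a::euclidean_space \<Rightarrow> real"
  assumes S: "S \<in> lmeasurable" and f: "f \<in> borel_measurable (lebesgue_on S)" "\<And>x. x \<in> S \<Longrightarrow> 0 \<le> f x"
    and g: "g \<in> borel_measurable (lebesgue_on S)" "\<And>x. x \<in> S \<Longrightarrow> 0 \<le> g x"
    and eq: "\<And>B. B \<in> sets borel \<Longrightarrow>
      (\<integral>\<^sup>+x. ennreal (indicator B x * f x) \<partial>lebesgue_on S) = (\<integral>\<^sup>+x. ennreal (indicator B x * g x) \<partial>lebesgue_on S)"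
  shows "AE x in lebesgue_on S. f x = g x"
proof -
  interpret finite_measure "lebesgue_on S" using S by (rule finite_measure_lebesgue_on)
  have Sm: "S \<inter> space lebesgue \<in> sets lebesgue" using S by (simp add: fmeasurableD)
  have "AE x in lebesgue_on S. ennreal (f x) = ennreal (g x)"
  proof (rule density_unique_finite_measure)
    fix A assume "A \<in> sets (lebesgue_on S)"
    then have "A \<in> sets lebesgue" using S sets_restrict_space_iff[OF Sm] by simp
    then obtain B N N' where A: "A = B \<union> N" "N \<subseteq> N'" "N' \<in> null_sets lborel" and B: "B \<in> sets lborel"
      by (rule sets_completionE)
    have "AE x in lebesgue. x \<notin> N'" using A(3) by (intro AE_not_in null_sets_completionI)
    then have ae: "AE x in lebesgue_on S. x \<notin> N'"
      unfolding AE_restrict_space_iff[OF Sm] by eventually_elim simp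
    have "(\<integral>\<^sup>+x. ennreal (h x) * indicator A x \<partial>lebesgue_on S) = (\<integral>\<^sup>+x. ennreal (indicator B x * h x) \<partial>lebesgue_on S)"
      for h :: "'a \<Rightarrow> real"
      by (rule nn_integral_cong_AE, use ae in eventually_elim) (use A in \<open>auto simp: indicator_def\<close>)
    then show "(\<integral>\<^sup>+x. ennreal (f x) * indicator A x \<partial>lebesgue_on S) = (\<integral>\<^sup>+x. ennreal (g x) * indicator A x \<partial>lebesgue_on S)"
      using eq B by simp
  qed (use f g in auto)
  moreover have "AE x in lebesgue_on S. x \<in> S"
    by (rule AE_I2) simp
  ultimately show ?thesis by eventually_elim (use f(2) g(2) in auto)
qed

text \<open>If \<eta> exceeded \<open>c\<close> by \<open>d > 0\<close> at one point, it would be at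
  least \<open>d\<close> everywhere, and \<open>p * exp (- \<eta>)\<close> would have mass at most
  \<open>exp (- d) < 1\<close>. Below \<open>- c\<close> the argument is symmetric.\<close>

lemma normalized_log_ratio_bound:
  fixes p \<eta> :: "'b \<Rightarrow> real"
  assumes p: "integrable M p" "integral\<^sup>L M p = 1" "\<And>x. x \<in> space M \<Longrightarrow> 0 \<le> p x"
    and q: "integrable M (\<lambda>x. p x * exp (- \<eta> x))" "(\<integral>x. p x * exp (- \<eta> x) \<partial>M) = 1"
    and osc: "\<And>x y. x \<in> space M \<Longrightarrow> y \<in> space M \<Longrightarrow> \<eta> x - \<eta> y \<le> c"
    and x: "x \<in> space M"
  shows "\<bar>\<eta> x\<bar> \<le> c"
proof -
  have "\<eta> x \<le> c"
  proof (rule ccontr)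
    assume "\<not> \<eta> x \<le> c"
    define d where "d = \<eta> x - c"
    have d: "0 < d" using \<open>\<not> \<eta> x \<le> c\<close> by (simp add: d_def)
    have "(\<integral>x. p x * exp (- \<eta> x) \<partial>M) \<le> (\<integral>x. p x * exp (- d) \<partial>M)"
    proof (rule integral_mono[OF q(1)])
      fix y assume y: "y \<in> space M"
      have "d \<le> \<eta> y" using osc[OF x y] by (simp add: d_def)
      then show "p y * exp (- \<eta> y) \<le> p y * exp (- d)" using p(3)[OF y] by (simp add: mult_left_mono)
    qed (use p in simp)
    then have "1 \<le> exp (- d)" using p(2) q(2) by simp
    then show False using d by simp
  qed
  moreover have "- \<eta> x \<le> c"
  proof (rule ccontr)
    assume "\<not> - \<eta> x \<le> c"
    define d where "d = - \<eta> x - c"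
    have d: "0 < d" using \<open>\<not> - \<eta> x \<le> c\<close> by (simp add: d_def)
    have "(\<integral>x. p x * exp d \<partial>M) \<le> (\<integral>x. p x * exp (- \<eta> x) \<partial>M)"
    proof (rule integral_mono[OF _ q(1)])
      fix y assume y: "y \<in> space M"
      have "d \<le> - \<eta> y" using osc[OF y x] by (simp add: d_def)
      then show "p y * exp d \<le> p y * exp (- \<eta> y)" using p(3)[OF y] by (simp add: mult_left_mono)
    qed (use p in simp)
    then have "exp d \<le> 1" using p(2) q(2) by simp
    then show False using d by simp
  qed
  ultimately show ?thesis by simp
qed

text \<open>The elliptic equation makes \<open>\<omega> s (X s x) - ln (\<rho> (X s x))\<close> an
  antiderivative of the trace of the Hessian along the trajectory, which is the \<open>m\<close> of
  \<open>X_jacobian\<close>.\<close>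

lemma wlf_jacobian:
  assumes flow: "tangential_flow \<Omega> (\<lambda>t. grad \<Omega> (\<phi> t)) (\<lambda>t. hessian \<Omega> (\<phi> t)) X"
    and sol: "wlf_solution \<Omega> \<rho> \<omega>\<^sub>0 \<omega> \<phi> \<omega>\<^sub>m X"
    and C2: "\<And>t. 0 \<le> t \<Longrightarrow> Ck 2 \<Omega> S (\<phi> t)"
    and \<rho>: "\<And>x. x \<in> \<Omega> \<Longrightarrow> \<rho> differentiable at x" "\<And>x. x \<in> \<Omega> \<Longrightarrow> 0 < \<rho> x"
    and x: "x \<in> \<Omega>" and t: "0 \<le> t"
  shows "\<exists>D. (X t has_derivative D) (at x) \<and>
    edet D = exp (\<omega> t (X t x) - ln (\<rho> (X t x)) - (\<omega>\<^sub>0 x - ln (\<rho> x)))"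
proof -
  interpret tangential_flow \<Omega> "\<lambda>t. grad \<Omega> (\<phi> t)" "\<lambda>t. hessian \<Omega> (\<phi> t)" X by (rule flow)
  note xc = dom_closure[OF x]
  define m where "m = (\<lambda>s. \<omega> s (X s x) - ln (\<rho> (X s x)))"
  have "(m has_real_derivative (\<Sum>b\<in>Basis. hessian \<Omega> (\<phi> s) (X s x) b \<bullet> b)) (at s within {0..})"
    if s: "0 \<le> s" for s
  proof -
    let ?y = "X s x"
    have y: "?y \<in> \<Omega>" using X_in_dom[OF x s] .
    have 1: "((\<lambda>s. \<omega> s (X s x)) has_real_derivative - (\<omega> s ?y - \<omega>\<^sub>m s)) (at s within {0..})"
      using sol s xc by (simp add: wlf_solution_def)
    have "((\<lambda>s. \<rho> (X s x)) has_derivative (\<lambda>h. grad \<Omega> \<rho> ?y \<bullet> (h *\<^sub>R grad \<Omega> (\<phi> s) ?y))) (at s within {0..})"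
      using X_der[OF s xc] has_derivative_grad[OF \<rho>(1)[OF y] y] unfolding has_vector_derivative_def
      by (rule has_derivative_compose)
    then have 2: "((\<lambda>s. \<rho> (X s x)) has_real_derivative grad \<Omega> \<rho> ?y \<bullet> grad \<Omega> (\<phi> s) ?y) (at s within {0..})"
      by (simp add: has_field_derivative_def mult_commute_abs)
    have "(m has_real_derivative - (\<omega> s ?y - \<omega>\<^sub>m s) - grad \<Omega> \<rho> ?y \<bullet> grad \<Omega> (\<phi> s) ?y / \<rho> ?y) (at s within {0..})"
      unfolding m_def using \<rho>(2)[OF y] by (auto intro!: derivative_eq_intros 1 2)
    also have "- (\<omega> s ?y - \<omega>\<^sub>m s) = divergence (\<lambda>y. \<rho> y *\<^sub>R grad \<Omega> (\<phi> s) y) ?y / \<rho> ?y"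
      using sol s y by (simp add: wlf_solution_def)
    also have "\<dots> - grad \<Omega> \<rho> ?y \<bullet> grad \<Omega> (\<phi> s) ?y / \<rho> ?y = (\<Sum>b\<in>Basis. hessian \<Omega> (\<phi> s) ?y b \<bullet> b)"
      using divergence_scaled_grad[OF \<rho>(1)[OF y] C2[OF s] y] \<rho>(2)[OF y] by (simp add: field_simps)
    finally show ?thesis .
  qed
  from X_jacobian[OF x t this] have "\<exists>D. (X t has_derivative D) (at x) \<and> edet D = exp (m t - m 0)" .
  moreover have "m 0 = \<omega>\<^sub>0 x - ln (\<rho> x)"
    using sol xc by (simp add: m_def wlf_solution_def)
  ultimately show ?thesis by (simp add: m_def)
qed

lemma wlf_difference_decay:
  assumes sol: "wlf_solution \<Omega> \<rho> \<omega>\<^sub>0 \<omega> \<phi> \<omega>\<^sub>m X"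
    and x: "x \<in> closure \<Omega>" and y: "y \<in> closure \<Omega>" and t: "0 \<le> t"
  shows "\<omega> t (X t x) - \<omega> t (X t y) = exp (- t) * (\<omega>\<^sub>0 x - \<omega>\<^sub>0 y)"
proof -
  let ?d = "\<lambda>s. \<omega> s (X s x) - \<omega> s (X s y)"
  have "\<exists>c. \<forall>s\<in>{0..}. exp s * ?d s = c"
  proof (rule has_field_derivative_zero_constant)
    show "((\<lambda>s. exp s * ?d s) has_real_derivative 0) (at s within {0..})" if "s \<in> {0..}" for s
    proof -
      have 1: "((\<lambda>s. \<omega> s (X s z)) has_real_derivative - (\<omega> s (X s z) - \<omega>\<^sub>m s)) (at s within {0..})"
        if "z \<in> closure \<Omega>" for z
        using sol \<open>s \<in> {0..}\<close> that by (simp add: wlf_solution_def)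
      show ?thesis
        by (rule derivative_eq_intros 1[OF x] 1[OF y] refl)+ (simp add: algebra_simps)
    qed
  qed simp
  then obtain k where k: "\<And>s. 0 \<le> s \<Longrightarrow> exp s * ?d s = k" by auto
  have "exp t * ?d t = exp 0 * ?d 0" using k[OF t] k[of 0] by simp
  moreover have "?d 0 = \<omega>\<^sub>0 x - \<omega>\<^sub>0 y" using sol x y by (simp add: wlf_solution_def)
  ultimately show ?thesis by (simp add: exp_minus field_simps)
qed

theorem theorem4p2:
  fixes \<Omega> :: "'a::euclidean_space set"
    and \<rho> p q\<^sub>0 \<omega>\<^sub>0 :: "'a \<Rightarrow> real"
    and \<omega> \<phi> q \<eta> :: "real \<Rightarrow> 'a \<Rightarrow> real"
    and \<omega>\<^sub>m :: "real \<Rightarrow> real"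
    and X :: "real \<Rightarrow> 'a \<Rightarrow> 'a"
    and Z :: real
  assumes "smooth_bounded_domain \<Omega>"
    and "Cinf \<Omega> (closure \<Omega>) \<rho>"
    and "\<forall>x\<in>closure \<Omega>. 0 < \<rho> x"
    and "Z = (LINT x|lebesgue_on \<Omega>. \<rho> x)"
    and "\<forall>x. p x = \<rho> x / Z"
    and "\<forall>x\<in>\<Omega>. 0 < q\<^sub>0 x"
    and "has_bochner_integral (lebesgue_on \<Omega>) q\<^sub>0 1"
    and "\<omega>\<^sub>0 \<in> holder_space 0 1 \<Omega>"
    and "\<forall>x\<in>\<Omega>. \<omega>\<^sub>0 x = ln (\<rho> x) - ln (q\<^sub>0 x)"
    and "wlf_solution \<Omega> \<rho> \<omega>\<^sub>0 \<omega> \<phi> \<omega>\<^sub>m X"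
    and "wlf_regular \<Omega> \<omega> \<phi>"
    and "\<forall>t\<ge>0. pushforward_density \<Omega> (X t) q\<^sub>0 (q t)"
    and "\<forall>t x. \<eta> t x = \<omega> t x - ln Z"
  shows "(\<forall>t\<ge>0. AE x in lebesgue_on \<Omega>. 0 < q t x \<and> \<eta> t x = ln (p x / q t x)) \<and>
    (\<forall>t\<ge>0. Linf_norm \<Omega> (\<eta> t) \<le> ereal (exp (- t) * osc \<Omega> \<omega>\<^sub>0)) \<and>
    ((\<lambda>t. Linf_norm \<Omega> (\<lambda>x. q t x - p x)) \<longlongrightarrow> 0) at_top \<and>
    (\<forall>t\<ge>0. integrable (lebesgue_on \<Omega>) (\<lambda>x. q t x * ln (q t x / p x)) \<and>
       KL \<Omega> (q t) p \<le> exp (- t) * osc \<Omega> \<omega>\<^sub>0)"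
proof -
  let ?M = "lebesgue_on \<Omega>"
  have op: "open \<Omega>" and bdd: "bounded \<Omega>" and ne: "\<Omega> \<noteq> {}"
    using assms(1) by (auto simp: smooth_bounded_domain_def)
  have reg: "Cont_holder T 2 (1/2) \<Omega> \<phi>" "Cont_holder T 0 (1/2) \<Omega> \<omega>" if "0 < T" for T
    using assms(11) that by (auto simp: wlf_regular_def)
  have C2: "Ck 2 \<Omega> (closure \<Omega>) (\<phi> t)" if "0 \<le> t" for t
    using reg(1)[of "t + 1"] that by (auto simp: Cont_holder_def holder_space_def)
  have \<omega>_cont: "continuous_on (closure \<Omega>) (\<omega> t)" if "0 \<le> t" for t
    using reg(2)[of "t + 1"] that by (auto simp: Cont_holder_def holder_space_def)
  have \<omega>\<^sub>0_cont: "continuous_on (closure \<Omega>) \<omega>\<^sub>0"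
    using assms(8) by (simp add: holder_space_def)
  have "Ck 0 \<Omega> (closure \<Omega>) \<rho>" "Ck 1 \<Omega> (closure \<Omega>) \<rho>"
    using assms(2) by (simp_all only: Cinf_def)
  then have \<rho>_cont: "continuous_on (closure \<Omega>) \<rho>" and \<rho>_diff: "\<And>x. x \<in> \<Omega> \<Longrightarrow> \<rho> differentiable at x"
    by auto
  have flow: "tangential_flow \<Omega> (\<lambda>t. grad \<Omega> (\<phi> t)) (\<lambda>t. hessian \<Omega> (\<phi> t)) X"
    by (rule wlf_tangential_flow[OF assms(1,10) reg(1)])
  interpret tangential_flow \<Omega> "\<lambda>t. grad \<Omega> (\<phi> t)" "\<lambda>t. hessian \<Omega> (\<phi> t)" X by (rule flow)
  have lm: "\<Omega> \<in> lmeasurable" using op bdd by (simp add: lmeasurable_open)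
  interpret M: finite_measure ?M using lm by (rule finite_measure_lebesgue_on)
  have meas: "f \<in> borel_measurable ?M" if "continuous_on \<Omega> f" for f :: "'a \<Rightarrow> 'b::euclidean_space"
    using that lm by (intro continuous_imp_measurable_on_sets_lebesgue) (auto simp: fmeasurableD)
  have sub: "continuous_on \<Omega> f" if "continuous_on (closure \<Omega>) f" for f :: "'a \<Rightarrow> real"
    using that closure_subset by (rule continuous_on_subset)
  have bound: "\<exists>K. \<forall>x\<in>closure \<Omega>. \<bar>f x\<bar> \<le> K" if "continuous_on (closure \<Omega>) f" for f :: "'a \<Rightarrow> real"
    using compact_imp_bounded[OF compact_continuous_image[OF that]] bdd
    by (auto simp: bounded_iff compact_closure)
  have int: "integrable ?M f" if f: "continuous_on (closure \<Omega>) f" for f :: "'a \<Rightarrow> real"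
  proof -
    obtain K where K: "\<forall>x\<in>closure \<Omega>. \<bar>f x\<bar> \<le> K" using bound[OF f] by blast
    show ?thesis
    proof (rule M.integrable_const_bound)
      show "AE x in ?M. norm (f x) \<le> K" by (rule AE_I2) (use K dom_closure in simp)
    qed (rule meas[OF sub[OF f]])
  qed
  have \<rho>_pos: "0 < \<rho> x" if "x \<in> closure \<Omega>" for x using assms(3) that by blast

  \<comment> \<open>\<open>q t\<close> is fixed only up to null sets, so pointwise arguments use
    this continuous representative.\<close>
  define r where "r = (\<lambda>t y. \<rho> y * exp (- \<omega> t y))"
  have r_cont: "continuous_on (closure \<Omega>) (r t)" if "0 \<le> t" for t
    unfolding r_def by (intro continuous_intros \<rho>_cont \<omega>_cont that)
  have r_pos: "0 < r t y" if "y \<in> \<Omega>" for t y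
    using \<rho>_pos dom_closure that by (simp add: r_def)
  have q\<^sub>0: "q\<^sub>0 x = \<rho> x * exp (- \<omega>\<^sub>0 x)" if "x \<in> \<Omega>" for x
    using assms(6,9) \<rho>_pos[OF dom_closure[OF that]] that by (simp add: exp_diff)
  have "continuous_on \<Omega> (\<lambda>x. \<rho> x * exp (- \<omega>\<^sub>0 x))"
    by (intro continuous_intros sub \<rho>_cont \<omega>\<^sub>0_cont)
  then have q\<^sub>0_cont: "continuous_on \<Omega> q\<^sub>0" using q\<^sub>0 by (simp cong: continuous_on_cong)
  have q\<^sub>0_int: "(\<integral>\<^sup>+x. ennreal (q\<^sub>0 x) \<partial>?M) = 1"
  proof -
    have "(\<integral>\<^sup>+x. ennreal (q\<^sub>0 x) \<partial>?M) = ennreal (integral\<^sup>L ?M q\<^sub>0)"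
      using assms(6,7) by (intro nn_integral_eq_integral AE_I2) (auto simp: has_bochner_integral_iff less_imp_le)
    then show ?thesis using assms(7) by (simp add: has_bochner_integral_iff)
  qed
  have push: "(\<integral>\<^sup>+y. ennreal (indicator B y * r t y) \<partial>?M) = (\<integral>\<^sup>+x. ennreal (indicator B (X t x) * q\<^sub>0 x) \<partial>?M)"
    if t: "0 \<le> t" and B: "B \<in> sets borel" for t B
  proof (rule pushforward_of_jacobian[OF t sub[OF r_cont[OF t]] _ q\<^sub>0_cont _ _ B])
    fix x assume x: "x \<in> \<Omega>"
    obtain D where D: "(X t has_derivative D) (at x)"
      "edet D = exp (\<omega> t (X t x) - ln (\<rho> (X t x)) - (\<omega>\<^sub>0 x - ln (\<rho> x)))"
      using wlf_jacobian[OF flow assms(10) C2 \<rho>_diff \<rho>_pos[OF dom_closure] x t] by blast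
    have "0 < \<rho> x" "0 < \<rho> (X t x)" using \<rho>_pos dom_closure x X_in_dom[OF x t] by auto
    then have "\<bar>edet D\<bar> * r t (X t x) = \<rho> x * exp (- \<omega>\<^sub>0 x)"
      by (simp add: D(2) r_def exp_diff exp_add exp_minus field_simps)
    then show "\<exists>D. (X t has_derivative D) (at x) \<and> \<bar>edet D\<bar> * r t (X t x) = q\<^sub>0 x"
      using D(1) q\<^sub>0[OF x] by auto
  qed (use r_pos q\<^sub>0_int in \<open>auto intro: less_imp_le\<close>)
  have r_int: "integrable ?M (r t)" "integral\<^sup>L ?M (r t) = 1" if t: "0 \<le> t" for t
  proof -
    show int_r: "integrable ?M (r t)" by (rule int[OF r_cont[OF t]])
    have "ennreal (integral\<^sup>L ?M (r t)) = (\<integral>\<^sup>+y. ennreal (r t y) \<partial>?M)"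
      using r_pos by (intro nn_integral_eq_integral[symmetric] int_r AE_I2) (simp add: less_imp_le)
    also have "\<dots> = 1" using push[OF t, of UNIV] q\<^sub>0_int by simp
    finally show "integral\<^sup>L ?M (r t) = 1" by simp
  qed
  have q_eq: "AE x in ?M. q t x = r t x" if t: "0 \<le> t" for t
  proof (rule AE_eq_of_borel_integrals[OF lm])
    have pd: "pushforward_density \<Omega> (X t) q\<^sub>0 (q t)" using assms(12) t by blast
    then show q_meas: "q t \<in> borel_measurable ?M" and "\<And>x. x \<in> \<Omega> \<Longrightarrow> 0 \<le> q t x"
      by (auto simp: pushforward_density_def)
    show "r t \<in> borel_measurable ?M" by (rule meas[OF sub[OF r_cont[OF t]]])
    show "0 \<le> r t x" if "x \<in> \<Omega>" for x using r_pos[OF that] by (rule less_imp_le)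
    fix B :: "'a set" assume B: "B \<in> sets borel"
    have distr: "emeasure (distr (density ?M (\<lambda>x. ennreal (f x))) borel Y) B =
        (\<integral>\<^sup>+x. ennreal (indicator B (Y x) * f x) \<partial>?M)"
      if f: "f \<in> borel_measurable ?M" and Y: "Y \<in> borel_measurable ?M" for f :: "'a \<Rightarrow> real" and Y :: "'a \<Rightarrow> 'a"
    proof -
      have "Y -` B \<inter> space ?M \<in> sets ?M" using Y B by (rule measurable_sets)
      then have "emeasure (distr (density ?M (\<lambda>x. ennreal (f x))) borel Y) B =
          (\<integral>\<^sup>+x. ennreal (f x) * indicator (Y -` B \<inter> space ?M) x \<partial>?M)"
        using f Y B by (simp add: emeasure_distr emeasure_density)
      also have "\<dots> = (\<integral>\<^sup>+x. ennreal (indicator B (Y x) * f x) \<partial>?M)"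
        by (intro nn_integral_cong) (simp add: indicator_def)
      finally show ?thesis .
    qed
    have "(\<integral>\<^sup>+x. ennreal (indicator B x * q t x) \<partial>?M) = (\<integral>\<^sup>+x. ennreal (indicator B (X t x) * q\<^sub>0 x) \<partial>?M)"
      using distr[OF q_meas meas[OF continuous_on_id]] distr[OF meas[OF q\<^sub>0_cont] meas[OF X_continuous_dom[OF t]]] pd
      by (simp add: pushforward_density_def)
    then show "(\<integral>\<^sup>+x. ennreal (indicator B x * q t x) \<partial>?M) = (\<integral>\<^sup>+x. ennreal (indicator B x * r t x) \<partial>?M)"
      using push[OF t B] by simp
  qed

  \<comment> \<open>The mass of \<open>r 0\<close> is 1 and \<open>\<omega> 0\<close> is bounded by
    \<open>K\<close>, whence \<open>1 \<le> Z * exp K\<close>.\<close>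
  have Z: "0 < Z"
  proof -
    obtain K where K: "\<forall>x\<in>closure \<Omega>. \<bar>\<omega> 0 x\<bar> \<le> K" using bound[OF \<omega>_cont[of 0]] by auto
    have "integral\<^sup>L ?M (r 0) \<le> integral\<^sup>L ?M (\<lambda>x. \<rho> x * exp K)"
    proof (rule integral_mono)
      fix x assume "x \<in> space ?M"
      then have x: "x \<in> closure \<Omega>" using dom_closure by simp
      show "r 0 x \<le> \<rho> x * exp K" using K \<rho>_pos[OF x] x by (force simp: r_def abs_le_iff)
    qed (use r_int int[OF \<rho>_cont] in auto)
    then have "1 \<le> Z * exp K" using r_int(2)[of 0] assms(4) by simp
    then have "0 < Z * exp K" by simp
    then show ?thesis by (simp add: zero_less_mult_iff)
  qed
  have p_eq: "p = (\<lambda>x. \<rho> x / Z)" using assms(5) by auto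
  have p_pos: "0 < p x" if "x \<in> closure \<Omega>" for x using \<rho>_pos[OF that] Z by (simp add: p_eq)
  have p_cont: "continuous_on (closure \<Omega>) p" unfolding p_eq using Z by (intro continuous_intros \<rho>_cont) auto
  have p_int: "integral\<^sup>L ?M p = 1" using assms(4) Z by (simp add: p_eq)
  have \<eta>: "\<eta> t x = \<omega> t x - ln Z" for t x using assms(13) by blast
  have \<eta>_cont: "continuous_on (closure \<Omega>) (\<eta> t)" if "0 \<le> t" for t
    unfolding \<eta> by (intro continuous_intros \<omega>_cont that)
  have r_\<eta>: "r t x = p x * exp (- \<eta> t x)" for t x
    using Z by (simp add: r_def p_eq \<eta> exp_diff exp_minus field_simps)

  define c where "c = (\<lambda>t. exp (- t) * osc \<Omega> \<omega>\<^sub>0)"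
  have osc: "\<omega>\<^sub>0 x - \<omega>\<^sub>0 y \<le> osc \<Omega> \<omega>\<^sub>0" if "x \<in> closure \<Omega>" "y \<in> closure \<Omega>" for x y
  proof -
    have "bounded (\<omega>\<^sub>0 ` closure \<Omega>)"
      using bdd by (intro compact_imp_bounded compact_continuous_image \<omega>\<^sub>0_cont) (simp add: compact_closure)
    then have "\<omega>\<^sub>0 x \<le> (SUP x\<in>closure \<Omega>. \<omega>\<^sub>0 x)" "(INF x\<in>closure \<Omega>. \<omega>\<^sub>0 x) \<le> \<omega>\<^sub>0 y"
      using that by (auto intro!: cSUP_upper cINF_lower bounded_imp_bdd_above bounded_imp_bdd_below)
    then show ?thesis by (simp add: osc_def)
  qed
  have \<eta>_bound: "\<bar>\<eta> t x\<bar> \<le> c t" if t: "0 \<le> t" and x: "x \<in> \<Omega>" for t x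
  proof (rule normalized_log_ratio_bound[of ?M p "\<eta> t"])
    show "integrable ?M (\<lambda>x. p x * exp (- \<eta> t x))" "(\<integral>x. p x * exp (- \<eta> t x) \<partial>?M) = 1"
      using r_int[OF t] by (simp_all add: r_\<eta>[abs_def])
    show "\<eta> t y - \<eta> t z \<le> c t" if "y \<in> space ?M" "z \<in> space ?M" for y z
    proof -
      have "y \<in> X t ` \<Omega>" "z \<in> X t ` \<Omega>" using that X_image[OF t] by auto
      then obtain y' z' where y': "y' \<in> \<Omega>" "y = X t y'" and z': "z' \<in> \<Omega>" "z = X t z'" by blast
      show ?thesis
        using wlf_difference_decay[OF assms(10) dom_closure[OF y'(1)] dom_closure[OF z'(1)] t]
          osc[OF dom_closure[OF y'(1)] dom_closure[OF z'(1)]]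
        by (simp add: \<eta> y'(2) z'(2) c_def)
    qed
  qed (use x p_int int[OF p_cont] p_pos dom_closure in \<open>auto intro: less_imp_le\<close>)

  have 1: "AE x in ?M. 0 < q t x \<and> \<eta> t x = ln (p x / q t x)" if t: "0 \<le> t" for t
  proof -
    have "AE x in ?M. x \<in> \<Omega>" by (rule AE_I2) simp
    with q_eq[OF t] show ?thesis
    proof eventually_elim
      case (elim x)
      have q: "0 < q t x" using elim r_pos by simp
      have "p x = q t x * exp (\<eta> t x)" using elim by (simp add: r_\<eta> exp_minus)
      then have "p x / q t x = exp (\<eta> t x)" using q by simp
      then show ?case using q by simp
    qed
  qed
  have 2: "Linf_norm \<Omega> (\<eta> t) \<le> ereal (c t)" if t: "0 \<le> t" for t
    unfolding Linf_norm_def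
  proof (rule esssup_I)
    have [measurable]: "\<eta> t \<in> borel_measurable ?M" by (rule meas[OF sub[OF \<eta>_cont[OF t]]])
    show "(\<lambda>x. ereal \<bar>\<eta> t x\<bar>) \<in> borel_measurable ?M" by measurable
    show "AE x in ?M. ereal \<bar>\<eta> t x\<bar> \<le> ereal (c t)" by (rule AE_I2) (simp add: \<eta>_bound[OF t])
  qed
  have q_meas: "q t \<in> borel_measurable ?M" if "0 \<le> t" for t
    using assms(12) that by (simp add: pushforward_density_def)
  have p_meas: "p \<in> borel_measurable ?M" by (rule meas[OF sub[OF p_cont]])

  obtain P where P: "\<forall>x\<in>closure \<Omega>. \<bar>p x\<bar> \<le> P" using bound[OF p_cont] by blast
  have Linf_upper: "Linf_norm \<Omega> (\<lambda>x. q t x - p x) \<le> ereal (P * (exp (c t) - 1))" if t: "0 \<le> t" for t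
    unfolding Linf_norm_def
  proof (rule esssup_I)
    have [measurable]: "q t \<in> borel_measurable ?M" "p \<in> borel_measurable ?M" by (rule q_meas[OF t] p_meas)+
    show "(\<lambda>x. ereal \<bar>q t x - p x\<bar>) \<in> borel_measurable ?M" by measurable
    have "AE x in ?M. x \<in> \<Omega>" by (rule AE_I2) simp
    with q_eq[OF t] show "AE x in ?M. ereal \<bar>q t x - p x\<bar> \<le> ereal (P * (exp (c t) - 1))"
    proof eventually_elim
      case (elim x)
      \<comment> \<open>This is cosh >= 1; for nonnegative \<eta> it yields
        \<open>1 - exp (- \<eta>) \<le> exp \<eta> - 1\<close>.\<close>
      have "2 \<le> exp (\<eta> t x) + exp (- \<eta> t x)"
        using exp_ge_add_one_self[of "\<eta> t x"] exp_ge_add_one_self[of "- \<eta> t x"] by linarith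
      then have "\<bar>exp (- \<eta> t x) - 1\<bar> \<le> exp \<bar>\<eta> t x\<bar> - 1"
        by (cases "0 \<le> \<eta> t x") auto
      also have "\<dots> \<le> exp (c t) - 1" using \<eta>_bound[OF t] elim by simp
      finally have "\<bar>p x\<bar> * \<bar>exp (- \<eta> t x) - 1\<bar> \<le> P * (exp (c t) - 1)"
        using P dom_closure elim by (intro mult_mono) (auto intro: order_trans[OF abs_ge_zero])
      moreover have "q t x - p x = p x * (exp (- \<eta> t x) - 1)"
        using elim by (simp add: r_\<eta> algebra_simps)
      ultimately show ?case by (simp add: abs_mult)
    qed
  qed
  \<comment> \<open>On a null set the essential supremum would be minus infinity; \<Omega> is open
    and nonempty, hence of positive measure.\<close>
  have Linf_lower: "0 \<le> Linf_norm \<Omega> (\<lambda>x. q t x - p x)" for t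
  proof -
    have "\<not> negligible \<Omega>" using op ne by (simp add: open_not_negligible)
    then have "emeasure lebesgue \<Omega> \<noteq> 0"
      using lm by (auto simp: negligible_iff_null_sets null_sets_def fmeasurableD)
    then have "emeasure ?M (space ?M) \<noteq> 0" using lm by (simp add: emeasure_restrict_space fmeasurableD)
    then have "esssup ?M (\<lambda>x. 0 :: ereal) = 0" by (rule esssup_const)
    moreover have "esssup ?M (\<lambda>x. 0 :: ereal) \<le> Linf_norm \<Omega> (\<lambda>x. q t x - p x)"
      unfolding Linf_norm_def by (rule esssup_mono) auto
    ultimately show ?thesis by simp
  qed
  have 3: "((\<lambda>t. Linf_norm \<Omega> (\<lambda>x. q t x - p x)) \<longlongrightarrow> 0) at_top"
  proof (rule tendsto_sandwich[where f = "\<lambda>_. 0" and h = "\<lambda>t. ereal (P * (exp (c t) - 1))"])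
    have "((\<lambda>t::real. exp (- t)) \<longlongrightarrow> 0) at_top"
      by (rule filterlim_compose[OF exp_at_bot filterlim_uminus_at_bot_at_top])
    then have "((\<lambda>t. P * (exp (c t) - 1)) \<longlongrightarrow> P * (exp (0 * osc \<Omega> \<omega>\<^sub>0) - 1)) at_top"
      unfolding c_def by (intro tendsto_intros)
    then have "((\<lambda>t. P * (exp (c t) - 1)) \<longlongrightarrow> 0) at_top" by simp
    then have "((\<lambda>t. ereal (P * (exp (c t) - 1))) \<longlongrightarrow> ereal 0) at_top" by (rule tendsto_ereal)
    then show "((\<lambda>t. ereal (P * (exp (c t) - 1))) \<longlongrightarrow> 0) at_top" by (simp add: zero_ereal_def)
    show "\<forall>\<^sub>F t in at_top. Linf_norm \<Omega> (\<lambda>x. q t x - p x) \<le> ereal (P * (exp (c t) - 1))"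
      using eventually_ge_at_top[of 0] by eventually_elim (rule Linf_upper)
  qed (use Linf_lower in auto)

  have 4: "integrable ?M (\<lambda>x. q t x * ln (q t x / p x)) \<and> KL \<Omega> (q t) p \<le> c t" if t: "0 \<le> t" for t
  proof -
    have [measurable]: "q t \<in> borel_measurable ?M" "p \<in> borel_measurable ?M" "r t \<in> borel_measurable ?M"
      "\<eta> t \<in> borel_measurable ?M"
      by (rule q_meas[OF t] p_meas meas[OF sub[OF r_cont[OF t]]] meas[OF sub[OF \<eta>_cont[OF t]]])+
    \<comment> \<open>Almost everywhere \<open>ln (q t x / p x)\<close> is
      \<open>- \<eta> t x\<close>, so the divergence is the mean of \<open>- \<eta> t\<close> under
      the probability density \<open>r t\<close>, at most \<open>c t\<close>.\<close>
    have "AE x in ?M. x \<in> \<Omega>" by (rule AE_I2) simp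
    with q_eq[OF t] have ae: "AE x in ?M. q t x * ln (q t x / p x) = r t x * - \<eta> t x"
    proof eventually_elim
      case (elim x)
      have "q t x / p x = exp (- \<eta> t x)"
        using elim p_pos[OF dom_closure, of x] by (simp add: r_\<eta>)
      then show ?case using elim by simp
    qed
    have int_r\<eta>: "integrable ?M (\<lambda>x. r t x * - \<eta> t x)"
      by (intro int continuous_intros r_cont \<eta>_cont t)
    then have int_q: "integrable ?M (\<lambda>x. q t x * ln (q t x / p x))"
      using integrable_cong_AE[OF _ _ ae] by simp
    have "KL \<Omega> (q t) p = (\<integral>x. r t x * - \<eta> t x \<partial>?M)"
      unfolding KL_def using ae by (intro integral_cong_AE) auto
    also have "\<dots> \<le> (\<integral>x. r t x * c t \<partial>?M)"
    proof (rule integral_mono[OF int_r\<eta>])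
      fix x assume "x \<in> space ?M"
      then have x: "x \<in> \<Omega>" by simp
      show "r t x * - \<eta> t x \<le> r t x * c t"
        using \<eta>_bound[OF t x] r_pos[OF x] by (intro mult_left_mono) (auto simp: less_imp_le)
    qed (use r_int(1)[OF t] in simp)
    also have "\<dots> = c t" using r_int(2)[OF t] by simp
    finally show ?thesis using int_q by blast
  qed
  show ?thesis using 1 2 3 4 unfolding c_def by blast
qed

end
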